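(* Let $n\ge 2$, $d\ge 1$ be integers, let $K\ge 0$ and $M\ge 0$ be constants, $\beta>0$, $z_1,\dots,z_{n-1}\in\mathbb{R}^d$, and suppose that $\alpha\ge 1$. Let initial data $(x_i^0,v_i^0)\in\mathbb{R}^d\times\mathbb{R}^d$, $i=1,\dots,n$, satisfy $$\min_{1\le i\ne j\le n}|x_i^0-x_j^0|>0 .$$ Then there exists a global smooth solution $\{(x_i(t),v_i(t))\}_{i=1}^n$, $t\ge 0$, of the controlled singular Cucker-Smale system (given in the context) with initial data $(x_i(0),v_i(0))=(x_i^0,v_i^0)$, satisfying $$\min_{1\le i\ne j\le n}|x_i(t)-x_j(t)|>0\quad\text{for all } t\ge 0 .$$
   Context: The controlled singular Cucker-Smale system for $x_i(t),v_i(t)\in\mathbb{R}^d$, $i=1,\dots,n$, is $$\frac{dx_i}{dt}=v_i,\qquad \frac{dv_i}{dt}=\frac{K}{n}\sum_{j=1}^n\psi(r_{ij})(v_j-v_i)+M u_i,\qquad r_{ij}(t)=|x_j(t)-x_i(t)|,$$ with $|\cdot|$ the Euclidean norm and $K,M$ nonnegative constants, where $\psi(r)=r^{-\alpha}$ for $r>0$ ($\alpha>0$), and terms with $j=i$ in the sum are read as $0$. The control $u=(u_1,\dots,u_n)$ is $$u_1=-\phi(|x_1-x_2-z_1|^2)(x_1-x_2-z_1),$$ $$u_n=\phi(|x_{n-1}-x_n-z_{n-1}|^2)(x_{n-1}-x_n-z_{n-1}),$$ $$u_i=\phi(|x_{i-1}-x_i-z_{i-1}|^2)(x_{i-1}-x_i-z_{i-1})-\phi(|x_i-x_{i+1}-z_i|^2)(x_i-x_{i+1}-z_i)$$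 for $2\le i\le n-1$, where $\phi(r)=(1+r)^{-\beta}$ ($\beta>0$) and $z_1,\dots,z_{n-1}\in\mathbb{R}^d$ are given fixed vectors.
   Formalization: The formal theorem assumes K > 0 instead of K ≥ 0; at K = 0 the claim is false (n = 2, K = M = 0, x_1 = 0, v_1 = e, x_2 = e, v_2 = 0 gives free motion with a collision at t = 1). *)

theory Defs
  imports "HOL-Analysis.Analysis"
begin

text \<open>
  The \<open>n\<close> particles are indexed by \<open>{1..n}\<close>; the values of the functions below at other indices
  are irrelevant. A trajectory is a function \<open>x i t\<close> of the particle and the time.
\<close>

definition psi :: "real \<Rightarrow> real \<Rightarrow> real" where
  "psi \<alpha> r = r powr (- \<alpha>)"

definition phi :: "real \<Rightarrow> real \<Rightarrow> real" where
  "phi \<beta> r = (1 + r) powr (- \<beta>)"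

definition link_force ::
    "real \<Rightarrow> (nat \<Rightarrow> real ^ 'd) \<Rightarrow> (nat \<Rightarrow> real ^ 'd) \<Rightarrow> nat \<Rightarrow> real ^ 'd" where
  "link_force \<beta> z y i =
     phi \<beta> ((norm (y i - y (i + 1) - z i))\<^sup>2) *\<^sub>R (y i - y (i + 1) - z i)"

definition control ::
    "nat \<Rightarrow> real \<Rightarrow> (nat \<Rightarrow> real ^ 'd) \<Rightarrow> (nat \<Rightarrow> real ^ 'd) \<Rightarrow> nat \<Rightarrow> real ^ 'd" where
  "control n \<beta> z y i =
     (if i = 1 then - link_force \<beta> z y 1
      else if i = n then link_force \<beta> z y (n - 1)
      else link_force \<beta> z y (i - 1) - link_force \<beta> z y i)"

text \<open>
  The sum omits \<open>j = i\<close>, where the singular weight is undefined and the term is read as zero.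
  Derivatives are taken within \<open>{0..}\<close>, hence are one-sided at time zero.
\<close>

definition controlled_CS_solution ::
    "nat \<Rightarrow> real \<Rightarrow> real \<Rightarrow> real \<Rightarrow> real \<Rightarrow> (nat \<Rightarrow> real ^ 'd) \<Rightarrow>
     (nat \<Rightarrow> real \<Rightarrow> real ^ 'd) \<Rightarrow> (nat \<Rightarrow> real \<Rightarrow> real ^ 'd) \<Rightarrow> bool" where
  "controlled_CS_solution n K M \<alpha> \<beta> z x v \<longleftrightarrow>
     (\<forall>i\<in>{1..n}. \<forall>t\<ge>0.
        (x i has_vector_derivative v i t) (at t within {0..}) \<and>
        (v i has_vector_derivative
           (K / real n) *\<^sub>R
             (\<Sum>j\<in>{1..n} - {i}. psi \<alpha> (norm (x j t - x i t)) *\<^sub>R (v j t - v i t))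
           + M *\<^sub>R control n \<beta> z (\<lambda>k. x k t) i) (at t within {0..}))"

text \<open>
  \<open>f\<close> is \<open>C\<^sup>\<infinity>\<close> on \<open>S\<close>: \<open>D k\<close> is its \<open>k\<close>-th derivative, one-sided at boundary points of \<open>S\<close>.
\<close>

definition smooth_on :: "real set \<Rightarrow> (real \<Rightarrow> 'a::real_normed_vector) \<Rightarrow> bool" where
  "smooth_on S f \<longleftrightarrow>
     (\<exists>D :: nat \<Rightarrow> real \<Rightarrow> 'a. D 0 = f \<and>
        (\<forall>k. \<forall>t\<in>S. (D k has_vector_derivative D (Suc k) t) (at t within S)))"

definition min_distance :: "nat \<Rightarrow> (nat \<Rightarrow> real ^ 'd) \<Rightarrow> real" where
  "min_distance n y = Min {norm (y i - y j) | i j. i \<in> {1..n} \<and> j \<in> {1..n} \<and> i \<noteq> j}"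

text \<open>
  Avoidance of collisions requires a strictly positive coupling constant: for \<open>K = M = 0\<close> the
  particles move freely along straight lines and may meet.
\<close>

end

theory Submission
  imports Defs "HOL-Probability.Discrete_Topology"
begin

text \<open>
  Cutting off small distances and large velocities makes the system globally Lipschitz, so it
  suffices to show that on a bounded time interval a solution stays in a region where the cutoffs
  are inactive. Velocities and positions are bounded because the alignment term dissipates kinetic
  energy and the control grows at most linearly. Hence the positions converge at the end of the
  interval. If some of them had the same limit, consider the cluster of all these particles: the
  other particles keep a positive distance and act on it with a bounded force. With \<open>X\<close> and \<open>V\<close> the
  square roots of the sums of squared relative positions and velocities in the cluster, one has
  \<open>V' \<le> - c * V / X + C\<close> once \<open>X \<le> 1\<close>, since \<open>psi \<alpha> X \<ge> 1 / X\<close> for \<open>\<alpha> \<ge> 1\<close>. So \<open>V / X\<close> is integrable,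
  and it bounds the derivative of \<open>ln X\<close>, up to a constant factor; thus \<open>X\<close> cannot tend to zero.
\<close>

text \<open>Bounded velocities alone do not keep distances positive, and a colliding pair cannot be
  studied by itself: a third particle tending to the same point may act on it with an unbounded
  force. For a whole cluster such forces are internal. Since the weights are symmetric, they
  conserve momentum and only damp relative velocities, and each pair is damped at a rate
  proportional to at least \<open>1 / X\<close>, its distance being at most \<open>X\<close> and
  \<open>psi\<close> being decreasing. The factor is positive because \<open>K > 0\<close>. The
  exponent 1 is the borderline: the antiderivative \<open>ln X\<close> of \<open>1 / X\<close> is
  unbounded at zero. As \<open>V\<close> is a square root and may vanish, the argument is run with
  \<open>V\<^sup>2\<close> and a regularised root. Near collisions the field is unbounded, and the
  singular weights multiply velocities. The collision-free states are therefore exhausted by closed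
  regions, each with its own globally Lipschitz replacement of the field. A solution can stop only
  by leaving every region in finite time, which the estimates exclude.\<close>

instance bcontfun :: (metric_space, banach) banach ..

section \<open>Lipschitz differential equations in Banach spaces\<close>

text \<open>Integrating the exponential bound gains a factor \<open>1 / c\<close>. With
  \<open>c\<close> larger than the Lipschitz constant, this gain makes the Picard operator a
  contraction and also yields uniqueness.\<close>

lemma norm_integral_le_exp:
  fixes h :: "real \<Rightarrow> 'a::banach"
  assumes "continuous_on {0..s} h" and "\<And>r. r \<in> {0..s} \<Longrightarrow> norm (h r) \<le> C * exp (c * r)"
    and "0 \<le> s" "0 < c" "0 \<le> C"
  shows "norm (integral {0..s} h) \<le> C / c * exp (c * s)"
proof -
  have "((\<lambda>r. C * exp (c * r)) has_integral (C / c * exp (c * s) - C / c * exp (c * 0))) {0..s}"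
    using assms(3,4)
    by (intro fundamental_theorem_of_calculus)
       (auto intro!: derivative_eq_intros simp flip: has_real_derivative_iff_has_vector_derivative)
  moreover have "norm (integral {0..s} h) \<le> integral {0..s} (\<lambda>r. C * exp (c * r))"
    using assms by (intro integral_norm_bound_integral integrable_continuous_real continuous_intros) auto
  ultimately have "norm (integral {0..s} h) \<le> C / c * exp (c * s) - C / c"
    by (auto dest!: integral_unique)
  with assms show ?thesis by (smt (verit) divide_nonneg_pos)
qed

text \<open>Picard iteration with the weight \<open>exp (- c * t)\<close>, so that one fixed point
  covers all \<open>t \<ge> 0\<close>. The unknown \<open>z\<close> stands for the solution
  multiplied by this weight; it stays bounded although the solution itself may grow
  exponentially.\<close>

lemma lipschitz_ode_exists:
  fixes f :: "'a::banach \<Rightarrow> 'a"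
  assumes lip: "L-lipschitz_on UNIV f"
  obtains y where "y 0 = y0" "\<And>t. t \<ge> 0 \<Longrightarrow> (y has_vector_derivative f (y t)) (at t within {0..})"
proof -
  have L: "0 \<le> L" by (rule lipschitz_on_nonneg[OF lip])
  \<comment> \<open>Any positive \<open>c\<close> with \<open>L / c < 1\<close> would do; the
    summand 1 covers \<open>L = 0\<close>.\<close>
  define c where "c = 2 * L + 1"
  have c: "0 < c" using L by (simp add: c_def)
  define g where "g z r = f (exp (c * r) *\<^sub>R apply_bcontfun z r)" for z r
  \<comment> \<open>The weighted Picard operator. Through \<open>max 0 t\<close> it takes the
    constant value \<open>y0\<close> at negative times, since the fixed point is sought among
    bounded continuous functions on the whole line.\<close>
  define P where "P z t = exp (- c * max 0 t) *\<^sub>R (y0 + integral {0..max 0 t} (g z))" for z t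
  have contf: "continuous_on S f" for S
    using lipschitz_on_continuous_on[OF lip] continuous_on_subset by blast
  have contg: "continuous_on S (g z)" for S z
    unfolding g_def by (intro continuous_on_compose2[OF contf[of UNIV]] continuous_intros) auto
  have normf: "norm (f x) \<le> norm (f 0) + L * norm x" for x
    using lipschitz_on_normD[OF lip, of x 0] norm_triangle_sub[of "f x" "f 0"] by auto
  have P: "P z \<in> bcontfun" for z
  proof (rule bcontfun_normI)
    have *: "continuous_on {0..b} (\<lambda>t. integral {0..t} (g z))" for b
      by (intro indefinite_integral_continuous_1 integrable_continuous_real contg)
    have "isCont (\<lambda>t. integral {0..max 0 t} (g z)) t" for t
    proof -
      have "continuous_on {..<\<bar>t\<bar>+1} (\<lambda>t. integral {0..max 0 t} (g z))"
        by (intro continuous_on_compose2[OF *[of "\<bar>t\<bar>+1"]] continuous_intros) auto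
      then show ?thesis by (auto simp: continuous_on_eq_continuous_at)
    qed
    then have "continuous_on UNIV (\<lambda>t. integral {0..max 0 t} (g z))"
      by (simp add: continuous_on_eq_continuous_at)
    then show "continuous_on UNIV (P z)"
      unfolding P_def by (intro continuous_intros)
    fix t :: real
    define s where "s = max 0 t"
    have s: "0 \<le> s" by (simp add: s_def)
    let ?C = "norm (f 0) + L * norm z"
    have "norm (integral {0..s} (g z)) \<le> ?C / c * exp (c * s)"
    proof (rule norm_integral_le_exp[OF contg _ s c])
      fix r assume r: "r \<in> {0..s}"
      have "norm (g z r) \<le> norm (f 0) + L * (exp (c * r) * norm (z r))"
        unfolding g_def using normf[of "exp (c * r) *\<^sub>R z r"] by simp
      also have "\<dots> \<le> norm (f 0) * exp (c * r) + L * (exp (c * r) * norm z)"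
        using r c L by (intro add_mono mult_left_mono norm_bounded) (auto simp: mult_le_cancel_left1)
      finally show "norm (g z r) \<le> ?C * exp (c * r)" by (simp add: algebra_simps)
    qed (use L in auto)
    then have "norm (y0 + integral {0..s} (g z)) \<le> norm y0 * exp (c * s) + ?C / c * exp (c * s)"
      using c s by (intro order_trans[OF norm_triangle_ineq] add_mono) (auto simp: mult_le_cancel_left1)
    then have "exp (- (c * s)) * norm (y0 + integral {0..s} (g z)) \<le> exp (- (c * s)) * ((norm y0 + ?C / c) * exp (c * s))"
      by (intro mult_left_mono) (auto simp: algebra_simps)
    also have "\<dots> = norm y0 + ?C / c" by (simp add: exp_minus)
    finally show "norm (P z t) \<le> norm y0 + ?C / c" by (simp add: P_def s_def)
  qed
  define \<Phi> where "\<Phi> z = Bcontfun (P z)" for z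
  have \<Phi>: "apply_bcontfun (\<Phi> z) = P z" for z
    unfolding \<Phi>_def by (rule Bcontfun_inverse[OF P])
  have contr: "dist (\<Phi> z) (\<Phi> w) \<le> L / c * dist z w" for z w
  proof (rule dist_bound)
    fix t :: real
    define s where "s = max 0 t"
    have s: "0 \<le> s" by (simp add: s_def)
    have "norm (integral {0..s} (\<lambda>r. g z r - g w r)) \<le> (L * dist z w) / c * exp (c * s)"
    proof (rule norm_integral_le_exp[OF _ _ s c])
      fix r
      have "norm (g z r - g w r) \<le> L * norm (exp (c * r) *\<^sub>R z r - exp (c * r) *\<^sub>R w r)"
        unfolding g_def by (rule lipschitz_on_normD[OF lip]) auto
      also have "\<dots> = L * (exp (c * r) * dist (z r) (w r))"
        by (simp add: dist_norm flip: scaleR_diff_right)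
      also have "\<dots> \<le> L * (exp (c * r) * dist z w)"
        using L by (intro mult_left_mono dist_bounded) auto
      finally show "norm (g z r - g w r) \<le> L * dist z w * exp (c * r)" by (simp add: algebra_simps)
    qed (use L in \<open>auto intro!: continuous_intros contg\<close>)
    moreover have "integral {0..s} (\<lambda>r. g z r - g w r) = integral {0..s} (g z) - integral {0..s} (g w)"
      by (intro integral_diff integrable_continuous_real contg)
    ultimately have "exp (- (c * s)) * norm (integral {0..s} (g z) - integral {0..s} (g w))
        \<le> exp (- (c * s)) * (L / c * dist z w * exp (c * s))"
      by (intro mult_left_mono) (auto simp: algebra_simps)
    also have "\<dots> = L / c * dist z w" by (simp add: exp_minus)
    finally have "exp (- (c * s)) * norm (integral {0..s} (g z) - integral {0..s} (g w)) \<le> L / c * dist z w" .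
    moreover have "dist (P z t) (P w t) = exp (- (c * s)) * norm (integral {0..s} (g z) - integral {0..s} (g w))"
      by (simp add: P_def dist_norm flip: s_def scaleR_diff_right)
    ultimately show "dist (\<Phi> z t) (\<Phi> w t) \<le> L / c * dist z w" by (simp add: \<Phi>)
  qed
  have "\<exists>!z. \<Phi> z = z"
    using contr L c by (intro banach_fix_type[where c = "L / c"]) (auto simp: c_def)
  then obtain z where z: "\<Phi> z = z" by blast
  define y where "y t = exp (c * t) *\<^sub>R apply_bcontfun z t" for t
  have y: "y t = y0 + integral {0..t} (\<lambda>r. f (y r))" if "0 \<le> t" for t
  proof -
    have "apply_bcontfun z t = exp (- c * t) *\<^sub>R (y0 + integral {0..t} (g z))"
      using that \<Phi>[of z] by (simp add: z P_def)
    then show ?thesis by (simp add: y_def g_def[abs_def] exp_minus)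
  qed
  show ?thesis
  proof
    show "y 0 = y0" using y[of 0] by simp
    fix t :: real assume t: "0 \<le> t"
    have "continuous_on {0..t+1} (\<lambda>r. f (y r))"
      using contg[of _ z] by (simp add: g_def y_def)
    then have "((\<lambda>t. integral {0..t} (\<lambda>r. f (y r))) has_vector_derivative f (y t)) (at t within {0..t+1})"
      using t by (intro integral_has_vector_derivative) auto
    then have "((\<lambda>t. y0 + integral {0..t} (\<lambda>r. f (y r))) has_vector_derivative f (y t)) (at t within {0..t+1})"
      by (auto intro!: derivative_eq_intros)
    then have "(y has_vector_derivative f (y t)) (at t within {0..t+1})"
      by (rule has_vector_derivative_transform[rotated 2]) (use t y in auto)
    moreover have "at t within {0..t+1} = at t within {0..}"
      by (rule at_within_nhd[where S = "{..<t+1}"]) auto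
    ultimately show "(y has_vector_derivative f (y t)) (at t within {0..})" by simp
  qed
qed

text \<open>The weighted distance \<open>e\<close> of the two solutions has a maximum on the compact
  interval. The integrated equation at a maximum point \<open>s\<close> gives
  \<open>e s \<le> L / c * e s\<close> with \<open>L / c < 1\<close>, so the maximum is
  zero.\<close>

lemma lipschitz_ode_unique:
  fixes f :: "'a::banach \<Rightarrow> 'a"
  assumes lip: "L-lipschitz_on UNIV f"
    and y: "\<And>t. t \<in> {0..T} \<Longrightarrow> (y has_vector_derivative f (y t)) (at t within {0..T})"
    and w: "\<And>t. t \<in> {0..T} \<Longrightarrow> (w has_vector_derivative f (w t)) (at t within {0..T})"
    and "y 0 = w 0" and t: "t \<in> {0..T}"
  shows "y t = w t"
proof -
  have L: "0 \<le> L" by (rule lipschitz_on_nonneg[OF lip])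
  define c where "c = 2 * L + 1"
  have c: "0 < c" using L by (simp add: c_def)
  have conty: "continuous_on {0..T} y" "continuous_on {0..T} w"
    by (auto intro: continuous_on_vector_derivative y w)
  define e where "e t = exp (- c * t) * norm (y t - w t)" for t
  have "continuous_on {0..T} e"
    unfolding e_def by (intro continuous_intros conty)
  then obtain s where s: "s \<in> {0..T}" and max: "\<And>r. r \<in> {0..T} \<Longrightarrow> e r \<le> e s"
    using continuous_attains_sup[of "{0..T}" e] t by auto
  have contf: "continuous_on S f" for S
    using lipschitz_on_continuous_on[OF lip] continuous_on_subset by blast
  have "((\<lambda>r. f (y r) - f (w r)) has_integral ((y s - w s) - (y 0 - w 0))) {0..s}"
    using s by (intro fundamental_theorem_of_calculus)
       (auto intro!: has_vector_derivative_diff intro: has_vector_derivative_within_subset[OF y] has_vector_derivative_within_subset[OF w])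
  then have "y s - w s = integral {0..s} (\<lambda>r. f (y r) - f (w r))"
    using \<open>y 0 = w 0\<close> by (simp add: integral_unique)
  also have "norm \<dots> \<le> (L * e s) / c * exp (c * s)"
  proof (rule norm_integral_le_exp)
    fix r assume r: "r \<in> {0..s}"
    have "norm (f (y r) - f (w r)) \<le> L * norm (y r - w r)"
      by (rule lipschitz_on_normD[OF lip]) auto
    also have "\<dots> = L * (e r * exp (c * r))" by (simp add: e_def exp_minus)
    also have "\<dots> \<le> L * (e s * exp (c * r))"
      using L r s by (intro mult_left_mono mult_right_mono max) auto
    finally show "norm (f (y r) - f (w r)) \<le> L * e s * exp (c * r)" by (simp add: algebra_simps)
  next
    show "continuous_on {0..s} (\<lambda>r. f (y r) - f (w r))"
      using s by (intro continuous_intros continuous_on_compose2[OF contf[of UNIV]] continuous_on_subset[OF conty(1)] continuous_on_subset[OF conty(2)]) auto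
  qed (use s L c in \<open>auto simp: e_def\<close>)
  finally have "exp (- c * s) * norm (y s - w s) \<le> exp (- c * s) * ((L * e s) / c * exp (c * s))"
    by (intro mult_left_mono) auto
  then have "e s \<le> L / c * e s" by (simp add: e_def exp_minus field_simps)
  then have "c * e s \<le> L * e s" using c by (simp add: field_simps)
  then have "(L + 1) * e s \<le> 0" by (simp add: c_def algebra_simps)
  then have "e s \<le> 0" using L by (simp add: mult_le_0_iff)
  then have "e t \<le> 0" using max[OF t] by simp
  then show ?thesis by (simp add: e_def mult_le_0_iff)
qed

text \<open>Blow-up alternative for a field \<open>F\<close> that is controlled only on the regions
  \<open>U k\<close>, where it coincides with a globally Lipschitz \<open>G k\<close>. At a finite
  end of the lifespan, \<open>apriori\<close> confines the curve to one \<open>U k\<close>,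
  closedness adds the end time, and \<open>int\<close> leaves room to go on inside
  \<open>U (Suc k)\<close>.\<close>

lemma ode_continuation:
  fixes F :: "'a::banach \<Rightarrow> 'a" and U :: "nat \<Rightarrow> 'a set"
  assumes lip: "\<And>k. \<exists>L. L-lipschitz_on UNIV (G k)"
    and eq: "\<And>k y. y \<in> U k \<Longrightarrow> G k y = F y"
    and closed: "\<And>k. closed (U k)"
    and int: "\<And>k. U k \<subseteq> interior (U (Suc k))"
    and y0: "y0 \<in> U m"
    and apriori: "\<And>y T. 0 < T \<Longrightarrow> y 0 = y0 \<Longrightarrow> (\<And>t. t \<in> {0..<T} \<Longrightarrow> y t \<in> (\<Union>k. U k)) \<Longrightarrow>
      (\<And>t. t \<in> {0..<T} \<Longrightarrow> (y has_vector_derivative F (y t)) (at t within {0..<T})) \<Longrightarrow>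
      \<exists>k. \<forall>t\<in>{0..<T}. y t \<in> U k"
  obtains y where "y 0 = y0" "\<And>t. 0 \<le> t \<Longrightarrow> y t \<in> (\<Union>k. U k)"
    "\<And>t. 0 \<le> t \<Longrightarrow> (y has_vector_derivative F (y t)) (at t within {0..})"
proof -
  have "mono U"
    using int interior_subset by (intro mono_iff_le_Suc[THEN iffD2]) blast
  then have mono: "U k \<subseteq> U l" if "k \<le> l" for k l
    using that by (rule monoD)
  have "\<exists>y. y 0 = y0 \<and> (\<forall>t\<ge>0. (y has_vector_derivative G k (y t)) (at t within {0..}))" for k
    using lip[of k] lipschitz_ode_exists[of _ "G k" y0] by metis
  then obtain Y where Y0: "Y k 0 = y0"
    and Y: "0 \<le> t \<Longrightarrow> (Y k has_vector_derivative G k (Y k t)) (at t within {0..})" for k t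
    by metis
  have contY: "continuous_on {0..} (Y k)" for k
    by (rule continuous_on_vector_derivative) (use Y in auto)
  have agree: "y t = Y k t"
    if "y 0 = y0" "\<And>s. s \<in> {0..T} \<Longrightarrow> (y has_vector_derivative F (y s)) (at s within {0..T})"
      "\<And>s. s \<in> {0..T} \<Longrightarrow> y s \<in> U k" "t \<in> {0..T}" for y k T t
  proof -
    obtain L where L: "L-lipschitz_on UNIV (G k)" using lip by blast
    show ?thesis
    proof (rule lipschitz_ode_unique[OF L])
      show "(y has_vector_derivative G k (y s)) (at s within {0..T})" if "s \<in> {0..T}" for s
        using \<open>\<And>s. s \<in> {0..T} \<Longrightarrow> (y has_vector_derivative F (y s)) (at s within {0..T})\<close>[OF that]
          eq[OF \<open>\<And>s. s \<in> {0..T} \<Longrightarrow> y s \<in> U k\<close>[OF that]] by simp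
      show "(Y k has_vector_derivative G k (Y k s)) (at s within {0..T})" if "s \<in> {0..T}" for s
        by (rule has_vector_derivative_within_subset[OF Y]) (use that in auto)
    qed (use that Y0 in auto)
  qed
  define valid where "valid k t \<longleftrightarrow> (\<forall>s\<in>{0..t}. Y k s \<in> U k)" for k t
  have solves: "(Y k has_vector_derivative F (Y k s)) (at s within {0..t})"
    if "valid k t" "s \<in> {0..t}" for k s t
    using has_vector_derivative_within_subset[OF Y[of s k], of "{0..t}"] that eq[of "Y k s" k]
    by (auto simp: valid_def)
  have same: "Y k s = Y l s" if k: "valid k t" and l: "valid l t" and s: "s \<in> {0..t}" for k l s t
  proof -
    define p where "p = max k l"
    have "Y k s = Y p s"
      by (rule agree[OF Y0 solves[OF k] _ s])
         (use k mono[of k p] in \<open>auto simp: valid_def p_def\<close>)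
    moreover have "Y l s = Y p s"
      by (rule agree[OF Y0 solves[OF l] _ s])
         (use l mono[of l p] in \<open>auto simp: valid_def p_def\<close>)
    ultimately show ?thesis by simp
  qed
  define A where "A = {t. 0 \<le> t \<and> (\<exists>k. valid k t)}"
  \<comment> \<open>An arbitrary valid index is chosen for each time; by \<open>same\<close> the
    value does not depend on it.\<close>
  define y where "y t = Y (SOME k. valid k t) t" for t
  have yY: "y s = Y k s" if "valid k t" "s \<in> {0..t}" for k s t
  proof -
    have k: "valid k s" using that by (auto simp: valid_def)
    then have "valid (SOME k. valid k s) s" by (rule someI)
    then show ?thesis unfolding y_def by (rule same[OF _ k]) (use that in auto)
  qed
  \<comment> \<open>Up to time \<open>t\<close> the curve \<open>Y (Suc k)\<close> equals
    \<open>Y k\<close>, so at \<open>t\<close> it lies in the interior of \<open>U (Suc k)\<close>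
    and by continuity remains there a little longer.\<close>
  have extend: "\<exists>e>0. valid (Suc k) (t + e)" if k: "valid k t" and t: "0 \<le> t" for k t
  proof -
    have eqY: "Y k s = Y (Suc k) s" if "s \<in> {0..t}" for s
      by (rule agree[OF Y0 solves[OF k] _ that])
         (use k mono[of k "Suc k"] in \<open>auto simp: valid_def\<close>)
    have "Y (Suc k) t \<in> interior (U (Suc k))"
      using eqY[of t] int[of k] k t by (fastforce simp: valid_def)
    moreover have "(Y (Suc k) \<longlongrightarrow> Y (Suc k) t) (at t within {0..})"
      using contY t by (simp add: continuous_on)
    ultimately have "\<forall>\<^sub>F s in at t within {0..}. Y (Suc k) s \<in> interior (U (Suc k))"
      by (intro topological_tendstoD) auto
    then obtain d where d: "d > 0"
      "\<And>s. 0 \<le> s \<Longrightarrow> s \<noteq> t \<Longrightarrow> dist s t < d \<Longrightarrow> Y (Suc k) s \<in> interior (U (Suc k))"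
      by (auto simp: eventually_at)
    have "Y (Suc k) s \<in> U (Suc k)" if s: "s \<in> {0..t + d/2}" for s
    proof (cases "s \<le> t")
      case True
      then show ?thesis using eqY[of s] k mono[of k "Suc k"] s by (fastforce simp: valid_def)
    next
      case False
      then have "Y (Suc k) s \<in> interior (U (Suc k))"
        using s d t by (intro d(2)) (auto simp: dist_real_def)
      then show ?thesis using interior_subset by blast
    qed
    then show ?thesis using d(1) by (intro exI[of _ "d/2"]) (auto simp: valid_def)
  qed
  have "valid m 0" using y0 Y0 by (simp add: valid_def)
  have A: "t \<in> A" if "0 \<le> t" for t
  proof (rule ccontr)
    assume t: "t \<notin> A"
    have down: "s \<in> A" if "s' \<in> A" "0 \<le> s" "s \<le> s'" for s s'
      using that by (force simp: A_def valid_def)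
    have bdd: "s \<le> t" if "s \<in> A" for s
      using down[OF that \<open>0 \<le> t\<close>] t by linarith
    have ne: "0 \<in> A" using \<open>valid m 0\<close> by (auto simp: A_def)
    define T where "T = Sup A"
    have upper: "s \<le> T" if "s \<in> A" for s
      unfolding T_def using bdd that by (intro cSup_upper bdd_aboveI[of A t]) auto
    have below: "s \<in> A" if "0 \<le> s" "s < T" for s
      using less_cSupD[of A s] that ne down unfolding T_def by (metis empty_iff less_imp_le)
    obtain e where "e > 0" "valid (Suc m) (0 + e)" using extend[OF \<open>valid m 0\<close>] by auto
    then have "T > 0" using upper[of e] by (fastforce simp: A_def)
    have "\<exists>k. \<forall>s\<in>{0..<T}. y s \<in> U k"
    proof (rule apriori[OF \<open>T > 0\<close>])
      show "y 0 = y0" using yY[OF \<open>valid m 0\<close>, of 0] Y0 by simp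
      fix s assume s: "s \<in> {0..<T}"
      then have "(s + T) / 2 \<in> A" by (intro below) (auto simp: field_simps)
      then obtain k where k: "valid k ((s + T) / 2)" by (auto simp: A_def)
      show "y s \<in> (\<Union>k. U k)"
        using yY[OF k, of s] k s by (auto simp: valid_def)
      have "(y has_vector_derivative F (Y k s)) (at s within {0..(s + T) / 2})"
        by (rule has_vector_derivative_transform[OF _ _ solves[OF k]]) (use yY[OF k] s in auto)
      moreover have "at s within {0..(s + T) / 2} = at s within {0..<T}"
        using s by (intro at_within_nhd[where S = "{..<(s + T) / 2}"]) auto
      ultimately show "(y has_vector_derivative F (y s)) (at s within {0..<T})"
        using yY[OF k, of s] s by simp
    qed
    then obtain k where k: "\<And>s. s \<in> {0..<T} \<Longrightarrow> y s \<in> U k" by blast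
    \<comment> \<open>Unlike \<open>y\<close>, the curve \<open>Y k\<close> is known to be
      continuous at \<open>T\<close>; agreement before \<open>T\<close> lets closedness of
      \<open>U k\<close> give \<open>valid k T\<close>.\<close>
    have "Y k s = y s" if s: "s \<in> {0..<T}" for s
    proof -
      have "s \<in> A" using s by (intro below) auto
      then obtain l where l: "valid l s" by (auto simp: A_def)
      have "Y l s = Y k s"
        by (rule agree[OF Y0 solves[OF l]]) (use s k yY[OF l, symmetric] in auto)
      then show ?thesis using yY[OF l, of s] s by auto
    qed
    then have Yk: "Y k ` {0..<T} \<subseteq> U k" using k by auto
    have "Y k ` closure {0..<T} \<subseteq> U k"
    proof (rule image_closure_subset[OF _ closed Yk])
      show "continuous_on (closure {0..<T}) (Y k)"
        using \<open>T > 0\<close> by (intro continuous_on_subset[OF contY]) auto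
    qed
    then have "valid k T" using \<open>T > 0\<close> by (auto simp: valid_def)
    then obtain e where e: "e > 0" "valid (Suc k) (T + e)" using extend \<open>T > 0\<close> by (meson less_imp_le)
    then have "T + e \<in> A" using \<open>T > 0\<close> by (auto simp: A_def)
    from upper[OF this] e(1) show False by simp
  qed
  show ?thesis
  proof
    show "y 0 = y0" using yY[OF \<open>valid m 0\<close>, of 0] Y0 by simp
    fix t :: real assume t: "0 \<le> t"
    then have "t + 1 \<in> A" by (intro A) auto
    then obtain k where k: "valid k (t + 1)" by (auto simp: A_def)
    show "y t \<in> (\<Union>k. U k)"
      using yY[OF k, of t] k t by (auto simp: valid_def)
    have "(y has_vector_derivative F (Y k t)) (at t within {0..t + 1})"
      by (rule has_vector_derivative_transform[OF _ _ solves[OF k]]) (use yY[OF k] t in auto)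
    moreover have "at t within {0..t + 1} = at t within {0..}"
      by (intro at_within_nhd[where S = "{..<t + 1}"]) auto
    ultimately show "(y has_vector_derivative F (y t)) (at t within {0..})"
      using yY[OF k, of t] t by simp
  qed
qed

section \<open>A priori estimates\<close>

text \<open>At interior points the derivative within \<open>{a..<T}\<close> is two-sided, and at
  \<open>a\<close> continuity suffices. The interval is open at \<open>T\<close> because solutions
  are not yet known to reach the end time.\<close>

lemma nonincreasing_on_halfopen:
  fixes f :: "real \<Rightarrow> real"
  assumes f: "\<And>t. t \<in> {a..<T} \<Longrightarrow> (f has_real_derivative f' t) (at t within {a..<T})"
    and le: "\<And>t. t \<in> {a<..<b} \<Longrightarrow> f' t \<le> 0" and "a \<le> b" "b < T"
  shows "f b \<le> f a"
proof (rule DERIV_nonpos_imp_decreasing_open[OF \<open>a \<le> b\<close>])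
  fix t assume t: "a < t" "t < b"
  have "at t within {a..<T} = at t"
    using t \<open>b < T\<close> by (intro at_within_nhd[where S = "{a<..<T}"]) auto
  then show "\<exists>y. (f has_real_derivative y) (at t) \<and> y \<le> 0"
    using f[of t] le[of t] t \<open>b < T\<close> by auto
next
  have "continuous_on {a..<T} f"
    using f by (intro DERIV_continuous_on)
  then show "continuous_on {a..b} f"
    by (rule continuous_on_subset) (use \<open>b < T\<close> in auto)
qed

lemma gronwall_on_halfopen:
  fixes Q :: "real \<Rightarrow> real"
  assumes Q: "\<And>t. t \<in> {0..<T} \<Longrightarrow> (Q has_real_derivative Q' t) (at t within {0..<T})"
    and le: "\<And>t. t \<in> {0..<T} \<Longrightarrow> Q' t \<le> A * Q t" and t: "t \<in> {0..<T}"
  shows "Q t \<le> Q 0 * exp (A * t)"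
proof -
  have "Q t * exp (- A * t) \<le> Q 0 * exp (- A * 0)"
  proof (rule nonincreasing_on_halfopen[where f = "\<lambda>t. Q t * exp (- A * t)"
        and f' = "\<lambda>t. (Q' t - A * Q t) * exp (- A * t)" and T = T])
    fix s assume "s \<in> {0..<T}"
    then show "((\<lambda>t. Q t * exp (- A * t)) has_real_derivative (Q' s - A * Q s) * exp (- A * s))
        (at s within {0..<T})"
      by (auto intro!: derivative_eq_intros Q simp: algebra_simps)
  next
    fix s assume "s \<in> {0<..<t}"
    then show "(Q' s - A * Q s) * exp (- A * s) \<le> 0"
      using le[of s] t by (intro mult_nonpos_nonneg) auto
  qed (use t in auto)
  then show ?thesis by (simp add: exp_minus field_simps)
qed

text \<open>
  For every \<open>\<eta> > 0\<close> the function \<open>sqrt (B + \<eta>\<^sup>2) - q / (2 p) * ln A\<close> grows at most linearly,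
  up to an error of order \<open>\<eta> / sqrt A\<close> which is absorbed by choosing \<open>\<eta>\<close> small.
\<close>

lemma logarithmic_barrier:
  fixes A B :: "real \<Rightarrow> real"
  assumes dA: "\<And>t. t \<in> {a..<T} \<Longrightarrow> (A has_real_derivative A' t) (at t within {a..<T})"
    and dB: "\<And>t. t \<in> {a..<T} \<Longrightarrow> (B has_real_derivative B' t) (at t within {a..<T})"
    and A: "\<And>t. t \<in> {a..<T} \<Longrightarrow> 0 < A t" and B: "\<And>t. t \<in> {a..<T} \<Longrightarrow> 0 \<le> B t"
    and A': "\<And>t. t \<in> {a..<T} \<Longrightarrow> - p * (sqrt (A t) * sqrt (B t)) \<le> A' t"
    and B': "\<And>t. t \<in> {a..<T} \<Longrightarrow> B' t \<le> - q * (B t / sqrt (A t)) + r * sqrt (B t)"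
    and "0 < p" "0 < q" "0 \<le> r" "a < T"
  obtains \<rho> where "\<rho> > 0" "\<And>t. t \<in> {a..<T} \<Longrightarrow> \<rho> \<le> A t"
proof -
  \<comment> \<open>Write \<open>X = sqrt A\<close> and \<open>V = sqrt B\<close>. Formally
    \<open>V' \<le> - q / (2 * X) * V + r / 2\<close>, while
    \<open>- \<kappa> * (A' / A) \<le> \<kappa> * p * V / X\<close>; this \<open>\<kappa>\<close>
    makes the two singular terms cancel.\<close>
  define \<kappa> where "\<kappa> = q / (2 * p)"
  \<comment> \<open>\<open>r / 2\<close> absorbs the forcing term and 1 the error of the
    regularisation.\<close>
  define s where "s = r / 2 + 1"
  have \<kappa>: "0 < \<kappa>" using assms by (simp add: \<kappa>_def)
  have s: "0 \<le> s" using assms by (simp add: s_def)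
  \<comment> \<open>Independent of \<open>b\<close> and of \<open>\<eta>\<close>: the summand 1
    dominates \<open>\<eta>\<close> in \<open>sqrt (B a + \<eta>\<^sup>2)\<close>.\<close>
  define \<Lambda> where "\<Lambda> = sqrt (B a) + 1 - \<kappa> * ln (A a) + s * (T - a)"
  have bound: "- \<kappa> * ln (A b) \<le> \<Lambda>" if b: "b \<in> {a..<T}" for b
  proof -
    have "continuous_on {a..<T} A" using dA by (rule DERIV_continuous_on)
    then have "continuous_on {a..b} A" by (rule continuous_on_subset) (use b in auto)
    then obtain c where c: "c \<in> {a..b}" "\<And>t. t \<in> {a..b} \<Longrightarrow> A c \<le> A t"
      using continuous_attains_inf[of "{a..b}" A] b by auto
    have Ac: "0 < A c" using c b by (intro A) auto
    \<comment> \<open>May depend on \<open>b\<close>: with \<open>A c\<close> the minimum of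
      \<open>A\<close> on \<open>{a..b}\<close>, one gets
      \<open>q / (2 * X) * \<eta> \<le> 1\<close> throughout that interval.\<close>
    define \<eta> where "\<eta> = min 1 (2 * sqrt (A c) / q)"
    have \<eta>: "0 < \<eta>" "\<eta> \<le> 1" "\<eta> \<le> 2 * sqrt (A c) / q" using Ac \<open>0 < q\<close> by (auto simp: \<eta>_def)
    define H where "H t = sqrt (B t + \<eta>\<^sup>2) - \<kappa> * ln (A t) - s * t" for t
    define H' where "H' t = B' t / (2 * sqrt (B t + \<eta>\<^sup>2)) - \<kappa> * (A' t / A t) - s" for t
    have "H b \<le> H a"
    proof (rule nonincreasing_on_halfopen[where f = H and f' = H' and T = T])
      fix t assume t: "t \<in> {a..<T}"
      have "0 < B t + \<eta>\<^sup>2" using B[OF t] \<eta>(1) by (simp add: add_nonneg_pos)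
      then have "((\<lambda>t. sqrt (B t + \<eta>\<^sup>2)) has_real_derivative inverse (sqrt (B t + \<eta>\<^sup>2)) / 2 * B' t)
          (at t within {a..<T})"
        by (rule DERIV_chain2[OF DERIV_real_sqrt])
           (use DERIV_add[OF dB[OF t] DERIV_const[of "\<eta>\<^sup>2"]] in simp)
      moreover have "((\<lambda>t. ln (A t)) has_real_derivative 1 / A t * A' t) (at t within {a..<T})"
        by (rule DERIV_chain2[OF DERIV_ln_divide[OF A[OF t]] dA[OF t]])
      ultimately have "(H has_real_derivative
          inverse (sqrt (B t + \<eta>\<^sup>2)) / 2 * B' t - \<kappa> * (1 / A t * A' t) - s * 1) (at t within {a..<T})"
        unfolding H_def by (intro DERIV_diff DERIV_cmult DERIV_ident)
      also have "inverse (sqrt (B t + \<eta>\<^sup>2)) / 2 * B' t - \<kappa> * (1 / A t * A' t) - s * 1 = H' t"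
        by (simp add: H'_def inverse_eq_divide)
      finally show "(H has_real_derivative H' t) (at t within {a..<T})" .
    next
      fix t assume "t \<in> {a<..<b}"
      then have t: "t \<in> {a..<T}" "A c \<le> A t" using b c by auto
      define X where "X = sqrt (A t)"
      define V where "V = sqrt (B t)"
      define G where "G = sqrt (B t + \<eta>\<^sup>2)"
      have X: "0 < X" "A t = X\<^sup>2" using A[OF t(1)] by (auto simp: X_def)
      have V: "0 \<le> V" "B t = V\<^sup>2" using B[OF t(1)] by (auto simp: V_def)
      have pos: "0 < B t + \<eta>\<^sup>2" using B[OF t(1)] \<eta>(1) by (simp add: add_nonneg_pos)
      then have G: "0 < G" by (simp add: G_def)
      have G2: "G\<^sup>2 = V\<^sup>2 + \<eta>\<^sup>2"
        using pos V(2) by (simp only: G_def real_sqrt_pow2 less_imp_le)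
      have GV: "V \<le> G"
        by (rule power2_le_imp_le) (use G G2 in simp_all)
      have GVe: "G \<le> V + \<eta>"
        by (rule power2_le_imp_le) (use V(1) \<eta>(1) G2 in \<open>simp_all add: power2_sum\<close>)
      \<comment> \<open>Differentiating the regularised root \<open>G\<close> yields the damping
        \<open>V\<^sup>2 / G\<close> instead of \<open>V\<close>; the loss is at most
        \<open>\<eta>\<close>, because \<open>V \<le> G \<le> V + \<eta>\<close>.\<close>
      have key: "V - V\<^sup>2 / G \<le> \<eta>"
      proof -
        have "V * G - V\<^sup>2 \<le> V * \<eta>" using mult_left_mono[OF GVe V(1)] by (simp add: power2_eq_square algebra_simps)
        also have "\<dots> \<le> G * \<eta>" using GV \<eta> by (intro mult_right_mono) auto
        finally show ?thesis using G by (simp add: field_simps)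
      qed
      have "q * \<eta> \<le> 2 * sqrt (A c)" using \<eta>(3) \<open>0 < q\<close> by (simp add: field_simps)
      also have "\<dots> \<le> 2 * X" using t(2) by (simp add: X_def)
      finally have qX: "q / (2 * X) * \<eta> \<le> 1" using X by (simp add: field_simps)
      have "B' t \<le> - q * (V\<^sup>2 / X) + r * V" using B'[OF t(1)] by (simp only: X_def[symmetric] V_def[symmetric] V(2)[symmetric])
      then have "B' t / (2 * G) \<le> (- q * (V\<^sup>2 / X) + r * V) / (2 * G)"
        using G by (intro divide_right_mono) auto
      also have "\<dots> = - (q / (2 * X)) * (V\<^sup>2 / G) + r / 2 * (V / G)"
        using G X by (simp add: field_simps)
      also have "\<dots> \<le> - (q / (2 * X)) * (V\<^sup>2 / G) + r / 2 * 1"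
        using GV G \<open>0 \<le> r\<close> by (intro add_left_mono mult_left_mono) auto
      finally have 1: "B' t / (2 * G) \<le> - (q / (2 * X)) * (V\<^sup>2 / G) + r / 2" by simp
      have "- A' t \<le> p * (X * V)" using A'[OF t(1)] by (simp add: X_def V_def)
      then have "\<kappa> * (- A' t / X\<^sup>2) \<le> \<kappa> * (p * (X * V) / X\<^sup>2)"
        using \<kappa> by (intro mult_left_mono divide_right_mono) auto
      also have "\<dots> = q / (2 * X) * V"
        using X \<open>0 < p\<close> by (simp add: \<kappa>_def power2_eq_square field_simps)
      finally have 2: "- \<kappa> * (A' t / A t) \<le> q / (2 * X) * V" using X by simp
      have "q / (2 * X) * (V - V\<^sup>2 / G) \<le> q / (2 * X) * \<eta>"
        using X \<open>0 < q\<close> by (intro mult_left_mono key) auto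
      then have 3: "q / (2 * X) * V - q / (2 * X) * (V\<^sup>2 / G) \<le> 1"
        using qX by (simp add: algebra_simps)
      have "H' t = B' t / (2 * G) + - \<kappa> * (A' t / A t) - s" by (simp add: H'_def G_def)
      with 1 2 3 show "H' t \<le> 0" unfolding s_def by linarith
    qed (use b in auto)
    moreover have "0 \<le> sqrt (B b + \<eta>\<^sup>2)" using B[OF b] by simp
    moreover have "sqrt (B a + \<eta>\<^sup>2) \<le> sqrt (B a) + \<eta>"
      using sqrt_add_le_add_sqrt[of "B a" "\<eta>\<^sup>2"] B[of a] \<eta>(1) \<open>a < T\<close> by simp
    moreover have "s * (b - a) \<le> s * (T - a)" using b s by (intro mult_left_mono) auto
    ultimately show ?thesis using \<eta>(2) unfolding H_def \<Lambda>_def right_diff_distrib by linarith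
  qed
  show ?thesis
  proof
    show "exp (- \<Lambda> / \<kappa>) > 0" by simp
    fix t assume t: "t \<in> {a..<T}"
    have "- \<Lambda> / \<kappa> \<le> ln (A t)" using bound[OF t] \<kappa> by (simp add: field_simps)
    then have "exp (- \<Lambda> / \<kappa>) \<le> exp (ln (A t))" by (subst exp_le_cancel_iff)
    then show "exp (- \<Lambda> / \<kappa>) \<le> A t" using A[OF t] by simp
  qed
qed

section \<open>Sums over pairs and the dynamics within a cluster\<close>

text \<open>Obtained by expanding the product. It is applied to forces \<open>g\<close> with sum
  zero, for which only the first term on the right survives.\<close>

lemma sum_pairs_inner:
  fixes f g :: "'i \<Rightarrow> 'a::real_inner"
  shows "(\<Sum>i\<in>C. \<Sum>j\<in>C. (f i - f j) \<bullet> (g i - g j))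
    = 2 * real (card C) * (\<Sum>i\<in>C. f i \<bullet> g i) - 2 * ((\<Sum>i\<in>C. f i) \<bullet> (\<Sum>i\<in>C. g i))"
proof -
  have "(\<Sum>i\<in>C. \<Sum>j\<in>C. (f i - f j) \<bullet> (g i - g j))
    = (\<Sum>i\<in>C. \<Sum>j\<in>C. f i \<bullet> g i) + (\<Sum>i\<in>C. \<Sum>j\<in>C. f j \<bullet> g j)
      - (\<Sum>i\<in>C. \<Sum>j\<in>C. f i \<bullet> g j) - (\<Sum>i\<in>C. \<Sum>j\<in>C. f j \<bullet> g i)"
    by (simp add: inner_diff_left inner_diff_right sum.distrib sum_subtractf)
  moreover have "(\<Sum>i\<in>C. \<Sum>j\<in>C. f j \<bullet> g i) = (\<Sum>i\<in>C. \<Sum>j\<in>C. f i \<bullet> g j)"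
    by (rule sum.swap)
  moreover have "(\<Sum>i\<in>C. f i) \<bullet> (\<Sum>i\<in>C. g i) = (\<Sum>i\<in>C. \<Sum>j\<in>C. f i \<bullet> g j)"
    by (simp add: inner_sum_left inner_sum_right) (rule sum.swap)
  ultimately show ?thesis by (simp flip: sum_distrib_left)
qed

text \<open>Interchanging \<open>i\<close> and \<open>j\<close> changes the sign of the differences
  but not of the weights. So the total force cancels, and averaging the power with its interchanged
  form produces the squares.\<close>

lemma sum_graph_laplacian:
  fixes v :: "'i \<Rightarrow> 'a::real_inner" and w :: "'i \<Rightarrow> 'i \<Rightarrow> real"
  assumes sym: "\<And>i j. w i j = w j i"
  shows "(\<Sum>i\<in>C. \<Sum>j\<in>C. w i j *\<^sub>R (v j - v i)) = 0"
    and "(\<Sum>i\<in>C. v i \<bullet> (\<Sum>j\<in>C. w i j *\<^sub>R (v j - v i)))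
      = - (\<Sum>i\<in>C. \<Sum>j\<in>C. w i j * (norm (v i - v j))\<^sup>2) / 2"
proof -
  have "(\<Sum>i\<in>C. \<Sum>j\<in>C. w i j *\<^sub>R (v j - v i)) = (\<Sum>i\<in>C. \<Sum>j\<in>C. w i j *\<^sub>R (v i - v j))"
    by (subst sum.swap) (simp add: sym)
  also have "\<dots> = - (\<Sum>i\<in>C. \<Sum>j\<in>C. w i j *\<^sub>R (v j - v i))"
    by (simp add: algebra_simps flip: sum_negf)
  finally show "(\<Sum>i\<in>C. \<Sum>j\<in>C. w i j *\<^sub>R (v j - v i)) = 0"
    by (simp only: eq_neg_iff_add_eq_0 flip: scaleR_2) simp
  let ?S = "\<Sum>i\<in>C. \<Sum>j\<in>C. w i j * (v i \<bullet> (v j - v i))"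
  have "?S = (\<Sum>i\<in>C. \<Sum>j\<in>C. w i j * (v j \<bullet> (v i - v j)))"
    by (subst sum.swap) (simp add: sym)
  then have "?S + ?S = (\<Sum>i\<in>C. \<Sum>j\<in>C. w i j * (v i \<bullet> (v j - v i)) + w i j * (v j \<bullet> (v i - v j)))"
    by (simp add: sum.distrib)
  also have "\<dots> = (\<Sum>i\<in>C. \<Sum>j\<in>C. - (w i j * (norm (v i - v j))\<^sup>2))"
    by (intro sum.cong refl) (simp add: power2_norm_eq_inner inner_diff_left inner_diff_right inner_commute algebra_simps)
  also have "\<dots> = - (\<Sum>i\<in>C. \<Sum>j\<in>C. w i j * (norm (v i - v j))\<^sup>2)"
    by (simp add: sum_negf)
  finally show "(\<Sum>i\<in>C. v i \<bullet> (\<Sum>j\<in>C. w i j *\<^sub>R (v j - v i)))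
      = - (\<Sum>i\<in>C. \<Sum>j\<in>C. w i j * (norm (v i - v j))\<^sup>2) / 2"
    by (simp add: inner_sum_right)
qed

text \<open>For positions this is \<open>X\<^sup>2\<close> and for velocities
  \<open>V\<^sup>2\<close> of the overview. In contrast to a maximum of distances it is
  differentiable, and it ignores the common motion of the cluster.\<close>

definition pair_energy :: "'i set \<Rightarrow> ('i \<Rightarrow> 'a::real_inner) \<Rightarrow> real" where
  "pair_energy C y = (\<Sum>i\<in>C. \<Sum>j\<in>C. (norm (y i - y j))\<^sup>2)"

lemma pair_energy_nonneg: "0 \<le> pair_energy C y"
  unfolding pair_energy_def by (intro sum_nonneg) auto

lemma norm_le_sqrt_pair_energy:
  assumes "finite C" "i \<in> C" "j \<in> C"
  shows "norm (y i - y j) \<le> sqrt (pair_energy C y)"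
proof (rule real_le_rsqrt)
  have "(norm (y i - y j))\<^sup>2 \<le> (\<Sum>j\<in>C. (norm (y i - y j))\<^sup>2)"
    using assms by (intro member_le_sum) auto
  also have "\<dots> \<le> pair_energy C y"
    unfolding pair_energy_def
    using assms by (intro member_le_sum[where f = "\<lambda>i. \<Sum>j\<in>C. (norm (y i - y j))\<^sup>2"]) (auto intro: sum_nonneg)
  finally show "(norm (y i - y j))\<^sup>2 \<le> pair_energy C y" .
qed

lemma has_real_derivative_power2_norm:
  fixes f :: "real \<Rightarrow> 'a::real_inner"
  assumes "(f has_vector_derivative f') (at t within S)"
  shows "((\<lambda>t. (norm (f t))\<^sup>2) has_real_derivative 2 * (f t \<bullet> f')) (at t within S)"
  unfolding power2_norm_eq_inner has_real_derivative_iff_has_vector_derivative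
  using bounded_bilinear.has_vector_derivative[OF bounded_bilinear_inner assms assms]
  by (simp add: inner_commute)

lemma has_real_derivative_pair_energy:
  fixes y :: "'i \<Rightarrow> real \<Rightarrow> 'a::real_inner"
  assumes "\<And>i. i \<in> C \<Longrightarrow> (y i has_vector_derivative y' i) (at t within S)"
  shows "((\<lambda>t. pair_energy C (\<lambda>i. y i t)) has_real_derivative
    2 * (\<Sum>i\<in>C. \<Sum>j\<in>C. (y i t - y j t) \<bullet> (y' i - y' j))) (at t within S)"
  unfolding pair_energy_def sum_distrib_left
  by (intro DERIV_sum has_real_derivative_power2_norm has_vector_derivative_diff assms)

lemma sum_pairs_inner_le:
  fixes f g :: "'i \<Rightarrow> 'a::real_inner"
  assumes "\<And>i j. i \<in> C \<Longrightarrow> j \<in> C \<Longrightarrow> norm (f i - f j) \<le> a"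
    "\<And>i j. i \<in> C \<Longrightarrow> j \<in> C \<Longrightarrow> norm (g i - g j) \<le> b"
  shows "\<bar>\<Sum>i\<in>C. \<Sum>j\<in>C. (f i - f j) \<bullet> (g i - g j)\<bar> \<le> (real (card C))\<^sup>2 * (a * b)"
proof -
  have "\<bar>(f i - f j) \<bullet> (g i - g j)\<bar> \<le> a * b" if "i \<in> C" "j \<in> C" for i j
    using Cauchy_Schwarz_ineq2[of "f i - f j" "g i - g j"] assms[OF that]
      mult_mono[of "norm (f i - f j)" a "norm (g i - g j)" b] norm_ge_zero[of "f i - f j"]
    by (smt (verit) norm_ge_zero)
  then have "\<bar>\<Sum>i\<in>C. \<Sum>j\<in>C. (f i - f j) \<bullet> (g i - g j)\<bar> \<le> (\<Sum>i\<in>C. \<Sum>j\<in>C. a * b)"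
    by (intro order_trans[OF sum_abs] sum_mono) auto
  then show ?thesis by (simp add: power2_eq_square mult.assoc)
qed

text \<open>The comparison behind \<open>1 \<le> \<alpha>\<close>: since \<open>r \<le> 1\<close>,
  passing from the exponent \<open>- 1\<close> to \<open>- \<alpha>\<close> can only increase the
  power.\<close>

lemma inverse_le_psi:
  assumes "1 \<le> \<alpha>" "0 < r" "r \<le> s" "s \<le> 1"
  shows "1 / s \<le> psi \<alpha> r"
proof -
  have "1 / s \<le> 1 / r" using assms by (simp add: frac_le)
  also have "\<dots> = r powr (- 1)" using assms by (simp add: powr_minus_divide)
  also have "\<dots> \<le> psi \<alpha> r" unfolding psi_def using assms by (intro powr_mono') auto
  finally show ?thesis .
qed

text \<open>
  The particles of \<open>C\<close> align at rate \<open>psi\<close>, which for \<open>\<alpha> \<ge> 1\<close> has a nonintegrable singularity: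
  the velocities within \<open>C\<close> decay before the particles can meet.
\<close>

lemma cluster_no_collapse:
  fixes x v a b :: "'i \<Rightarrow> real \<Rightarrow> 'a::real_inner"
  assumes C: "finite C" "p \<in> C" "q \<in> C" "p \<noteq> q"
    and x: "\<And>i t. i \<in> C \<Longrightarrow> t \<in> {t0..<T} \<Longrightarrow> (x i has_vector_derivative v i t) (at t within {t0..<T})"
    and v: "\<And>i t. i \<in> C \<Longrightarrow> t \<in> {t0..<T} \<Longrightarrow> (v i has_vector_derivative a i t) (at t within {t0..<T})"
    and a: "\<And>i t. i \<in> C \<Longrightarrow> t \<in> {t0..<T} \<Longrightarrow>
      a i t = c *\<^sub>R (\<Sum>j\<in>C. psi \<alpha> (norm (x j t - x i t)) *\<^sub>R (v j t - v i t)) + b i t"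
    and b: "\<And>i t. i \<in> C \<Longrightarrow> t \<in> {t0..<T} \<Longrightarrow> norm (b i t) \<le> B"
    and ne: "\<And>i j t. i \<in> C \<Longrightarrow> j \<in> C \<Longrightarrow> i \<noteq> j \<Longrightarrow> t \<in> {t0..<T} \<Longrightarrow> x i t \<noteq> x j t"
    and small: "\<And>t. t \<in> {t0..<T} \<Longrightarrow> pair_energy C (\<lambda>i. x i t) \<le> 1"
    and "0 < c" "1 \<le> \<alpha>" "t0 < T"
  obtains \<rho> where "\<rho> > 0" "\<And>t. t \<in> {t0..<T} \<Longrightarrow> \<rho> \<le> pair_energy C (\<lambda>i. x i t)"
proof -
  define m where "m = real (card C)"
  have m: "0 < m" using C by (auto simp: m_def card_gt_0_iff)
  have B: "0 \<le> B" using order_trans[OF norm_ge_zero b[OF C(2), of t0]] \<open>t0 < T\<close> by simp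
  define SX where "SX t = pair_energy C (\<lambda>i. x i t)" for t
  define SV where "SV t = pair_energy C (\<lambda>i. v i t)" for t
  define SX' where "SX' t = 2 * (\<Sum>i\<in>C. \<Sum>j\<in>C. (x i t - x j t) \<bullet> (v i t - v j t))" for t
  define SV' where "SV' t = 2 * (\<Sum>i\<in>C. \<Sum>j\<in>C. (v i t - v j t) \<bullet> (a i t - a j t))" for t
  have normX: "norm (x i t - x j t) \<le> sqrt (SX t)" if "i \<in> C" "j \<in> C" for i j t
    unfolding SX_def by (rule norm_le_sqrt_pair_energy[OF C(1) that, where y = "\<lambda>i. x i t"])
  have normV: "norm (v i t - v j t) \<le> sqrt (SV t)" if "i \<in> C" "j \<in> C" for i j t
    unfolding SV_def by (rule norm_le_sqrt_pair_energy[OF C(1) that, where y = "\<lambda>i. v i t"])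
  show ?thesis
  \<comment> \<open>With \<open>m\<close> particles: \<open>p\<close> is Cauchy-Schwarz over
    \<open>m\<^sup>2\<close> ordered pairs, \<open>q\<close> comes from the dissipation identity,
    and \<open>r\<close> from differences of two forces, each bounded by \<open>B\<close>.\<close>
  proof (rule logarithmic_barrier[where A = SX and B = SV and A' = SX' and B' = SV' and a = t0 and T = T
        and p = "2 * m\<^sup>2" and q = "2 * m * c" and r = "4 * m\<^sup>2 * B"])
    fix t assume t: "t \<in> {t0..<T}"
    show "(SX has_real_derivative SX' t) (at t within {t0..<T})"
      unfolding SX_def SX'_def using x t by (intro has_real_derivative_pair_energy) auto
    show "(SV has_real_derivative SV' t) (at t within {t0..<T})"
      unfolding SV_def SV'_def using v t by (intro has_real_derivative_pair_energy) auto
    show SXpos: "0 < SX t"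
      using normX[OF C(2,3), of t] ne[OF C(2,3,4) t] by (smt (verit) real_sqrt_gt_0_iff zero_less_norm_iff right_minus_eq)
    show "0 \<le> SV t" by (simp add: SV_def pair_energy_nonneg)
    have "\<bar>SX' t\<bar> \<le> 2 * (m\<^sup>2 * (sqrt (SX t) * sqrt (SV t)))"
      unfolding SX'_def m_def abs_mult
      using sum_pairs_inner_le[where C = C and f = "\<lambda>i. x i t" and g = "\<lambda>i. v i t", OF normX normV] by simp
    then show "- (2 * m\<^sup>2) * (sqrt (SX t) * sqrt (SV t)) \<le> SX' t" by (simp add: mult.assoc)
    define w where "w i j = psi \<alpha> (norm (x j t - x i t))" for i j
    have sym: "w i j = w j i" for i j by (simp add: w_def norm_minus_commute)
    define l where "l i = (\<Sum>j\<in>C. w i j *\<^sub>R (v j t - v i t))" for i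
    have "(\<Sum>i\<in>C. \<Sum>j\<in>C. (v i t - v j t) \<bullet> (a i t - a j t))
        = (\<Sum>i\<in>C. \<Sum>j\<in>C. c * ((v i t - v j t) \<bullet> (l i - l j)) + (v i t - v j t) \<bullet> (b i t - b j t))"
      by (intro sum.cong refl) (simp add: a[OF _ t] l_def w_def inner_diff_right inner_add_right algebra_simps)
    also have "\<dots> = c * (\<Sum>i\<in>C. \<Sum>j\<in>C. (v i t - v j t) \<bullet> (l i - l j))
        + (\<Sum>i\<in>C. \<Sum>j\<in>C. (v i t - v j t) \<bullet> (b i t - b j t))"
      by (simp add: sum.distrib sum_distrib_left)
    \<comment> \<open>The interaction forces \<open>l\<close> sum to zero, so the product of sums in
      \<open>sum_pairs_inner\<close> vanishes; its factor 2 cancels the one half of the dissipation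
      identity.\<close>
    also have "(\<Sum>i\<in>C. \<Sum>j\<in>C. (v i t - v j t) \<bullet> (l i - l j))
        = - m * (\<Sum>i\<in>C. \<Sum>j\<in>C. w i j * (norm (v i t - v j t))\<^sup>2)"
      using sum_graph_laplacian[of w "\<lambda>i. v i t" C, OF sym]
      unfolding sum_pairs_inner by (simp add: l_def m_def)
    also have "(\<Sum>i\<in>C. \<Sum>j\<in>C. (v i t - v j t) \<bullet> (b i t - b j t)) \<le> m\<^sup>2 * (sqrt (SV t) * (2 * B))"
    proof -
      have "norm (b i t - b j t) \<le> 2 * B" if "i \<in> C" "j \<in> C" for i j
        using norm_triangle_ineq4[of "b i t" "b j t"] b[OF that(1) t] b[OF that(2) t] by simp
      from sum_pairs_inner_le[where C = C and f = "\<lambda>i. v i t" and g = "\<lambda>i. b i t", OF normV this]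
      show ?thesis by (simp add: m_def)
    qed
    finally have 1: "SV' t \<le> 2 * (c * (- m * (\<Sum>i\<in>C. \<Sum>j\<in>C. w i j * (norm (v i t - v j t))\<^sup>2))
        + m\<^sup>2 * (sqrt (SV t) * (2 * B)))" by (simp add: SV'_def)
    have "SV t / sqrt (SX t) = (\<Sum>i\<in>C. \<Sum>j\<in>C. 1 / sqrt (SX t) * (norm (v i t - v j t))\<^sup>2)"
      by (simp add: SV_def pair_energy_def sum_divide_distrib)
    \<comment> \<open>Every distance in the cluster is at most \<open>sqrt (SX t) \<le> 1\<close>,
      which bounds all off-diagonal weights from below by the same number; diagonal terms
      vanish.\<close>
    also have "\<dots> \<le> (\<Sum>i\<in>C. \<Sum>j\<in>C. w i j * (norm (v i t - v j t))\<^sup>2)"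
    proof (intro sum_mono)
      fix i j assume ij: "i \<in> C" "j \<in> C"
      show "1 / sqrt (SX t) * (norm (v i t - v j t))\<^sup>2 \<le> w i j * (norm (v i t - v j t))\<^sup>2"
      proof (cases "i = j")
        case False
        have "1 / sqrt (SX t) \<le> w i j" unfolding w_def
          using normX[OF ij(2,1)] small[OF t] ne[OF ij False t] \<open>1 \<le> \<alpha>\<close>
          by (intro inverse_le_psi) (auto simp: SX_def)
        then show ?thesis by (intro mult_right_mono) auto
      qed simp
    qed
    finally have "2 * m * c * (SV t / sqrt (SX t)) \<le> 2 * m * c * (\<Sum>i\<in>C. \<Sum>j\<in>C. w i j * (norm (v i t - v j t))\<^sup>2)"
      using m \<open>0 < c\<close> by (intro mult_left_mono) auto
    with 1 show "SV' t \<le> - (2 * m * c) * (SV t / sqrt (SX t)) + 4 * m\<^sup>2 * B * sqrt (SV t)"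
      by (simp add: algebra_simps)
  qed (use m B \<open>0 < c\<close> \<open>t0 < T\<close> that in \<open>auto simp: SX_def\<close>)
qed

section \<open>Growth bounds for the controlled system\<close>

text \<open>The acceleration as a function of one configuration rather than of trajectories, so that
  it can serve as a vector field on states.\<close>

definition cs_acc ::
    "nat \<Rightarrow> real \<Rightarrow> real \<Rightarrow> real \<Rightarrow> real \<Rightarrow> (nat \<Rightarrow> real ^ 'd) \<Rightarrow>
     (nat \<Rightarrow> real ^ 'd) \<Rightarrow> (nat \<Rightarrow> real ^ 'd) \<Rightarrow> nat \<Rightarrow> real ^ 'd" where
  "cs_acc n K M \<alpha> \<beta> z x v i =
     (K / real n) *\<^sub>R (\<Sum>j\<in>{1..n} - {i}. psi \<alpha> (norm (x j - x i)) *\<^sub>R (v j - v i))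
     + M *\<^sub>R control n \<beta> z x i"

lemma phi_bounds: "0 < \<beta> \<Longrightarrow> 0 \<le> r \<Longrightarrow> 0 \<le> phi \<beta> r \<and> phi \<beta> r \<le> 1"
  using powr_mono[of "- \<beta>" 0 "1 + r"] by (simp add: phi_def)

lemma norm_link_force_le:
  assumes "0 < \<beta>"
  shows "norm (link_force \<beta> z y i) \<le> norm (y i) + norm (y (i + 1)) + norm (z i)"
proof -
  have "norm (link_force \<beta> z y i) \<le> 1 * norm (y i - y (i + 1) - z i)"
    unfolding link_force_def norm_scaleR
    using phi_bounds[OF assms, of "(norm (y i - y (i + 1) - z i))\<^sup>2"]
    by (intro mult_right_mono) auto
  also have "\<dots> \<le> norm (y i) + norm (y (i + 1)) + norm (z i)"
    using norm_triangle_ineq4[of "y i - y (i + 1)" "z i"] norm_triangle_ineq4[of "y i" "y (i + 1)"]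
    by simp
  finally show ?thesis .
qed

text \<open>Each control is a combination of at most two link forces. Their indices lie between 1
  and \<open>n - 1\<close>, so every \<open>y\<close> and \<open>z\<close> occurring in them has an
  index in \<open>{1..n}\<close>.\<close>

lemma norm_control_le:
  assumes "0 < \<beta>" "2 \<le> n" "i \<in> {1..n}"
    and y: "\<And>j. j \<in> {1..n} \<Longrightarrow> norm (y j) \<le> R" and z: "\<And>j. j \<in> {1..n} \<Longrightarrow> norm (z j) \<le> Z"
  shows "norm (control n \<beta> z y i) \<le> 2 * (2 * R + Z)"
proof -
  have link: "norm (link_force \<beta> z y j) \<le> 2 * R + Z" if "1 \<le> j" "j + 1 \<le> n" for j
    using norm_link_force_le[OF \<open>0 < \<beta>\<close>, of z y j] y[of j] y[of "j + 1"] z[of j] that by auto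
  have "0 \<le> 2 * R + Z" using order_trans[OF norm_ge_zero link[of 1]] assms by auto
  moreover have "norm (link_force \<beta> z y (i - 1) - link_force \<beta> z y i) \<le> 2 * (2 * R + Z)"
    if "i \<noteq> 1" "i \<noteq> n"
  proof -
    have "norm (link_force \<beta> z y (i - 1)) \<le> 2 * R + Z" "norm (link_force \<beta> z y i) \<le> 2 * R + Z"
      using that assms(3) by (auto intro!: link)
    then have "norm (link_force \<beta> z y (i - 1) - link_force \<beta> z y i) \<le> (2 * R + Z) + (2 * R + Z)"
      by (intro order_trans[OF norm_triangle_ineq4 add_mono])
    then show ?thesis by simp
  qed
  moreover have link_last: "norm (link_force \<beta> z y (n - 1)) \<le> 2 * R + Z"
    by (rule link) (use \<open>2 \<le> n\<close> in auto)
  ultimately show ?thesis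
    using link[of 1] link_last assms by (auto simp: control_def)
qed

text \<open>The term \<open>j = i\<close> may be inserted because its velocity difference is zero;
  the rest is the dissipation identity with nonnegative weights.\<close>

lemma cs_velocity_dissipation:
  fixes n :: nat and x v :: "nat \<Rightarrow> real ^ 'd"
  shows "(\<Sum>i\<in>{1..n}. v i \<bullet> (\<Sum>j\<in>{1..n} - {i}. psi \<alpha> (norm (x j - x i)) *\<^sub>R (v j - v i))) \<le> 0"
proof -
  have "(\<Sum>j\<in>{1..n} - {i}. psi \<alpha> (norm (x j - x i)) *\<^sub>R (v j - v i))
      = (\<Sum>j\<in>{1..n}. psi \<alpha> (norm (x j - x i)) *\<^sub>R (v j - v i))" for i
    by (rule sum.mono_neutral_left) auto
  then have "(\<Sum>i\<in>{1..n}. v i \<bullet> (\<Sum>j\<in>{1..n} - {i}. psi \<alpha> (norm (x j - x i)) *\<^sub>R (v j - v i)))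
      = (\<Sum>i\<in>{1..n}. v i \<bullet> (\<Sum>j\<in>{1..n}. psi \<alpha> (norm (x j - x i)) *\<^sub>R (v j - v i)))"
    by simp
  also have "\<dots> = - (\<Sum>i\<in>{1..n}. \<Sum>j\<in>{1..n}. psi \<alpha> (norm (x j - x i)) * (norm (v i - v j))\<^sup>2) / 2"
    by (rule sum_graph_laplacian(2)) (simp add: norm_minus_commute)
  also have "\<dots> \<le> 0" by (auto simp: psi_def intro!: sum_nonneg)
  finally show ?thesis .
qed

lemma cs_bounded:
  fixes x v :: "nat \<Rightarrow> real \<Rightarrow> real ^ 'd"
  assumes "2 \<le> n" "0 < K" "0 \<le> M" "0 < \<beta>"
    and x: "\<And>i t. i \<in> {1..n} \<Longrightarrow> t \<in> {0..<T} \<Longrightarrow> (x i has_vector_derivative v i t) (at t within {0..<T})"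
    and v: "\<And>i t. i \<in> {1..n} \<Longrightarrow> t \<in> {0..<T} \<Longrightarrow>
      (v i has_vector_derivative cs_acc n K M \<alpha> \<beta> z (\<lambda>k. x k t) (\<lambda>k. v k t) i) (at t within {0..<T})"
  obtains R where "R > 0"
    "\<And>i t. i \<in> {1..n} \<Longrightarrow> t \<in> {0..<T} \<Longrightarrow> norm (x i t) \<le> R \<and> norm (v i t) \<le> R"
proof -
  define Z where "Z = (\<Sum>i\<in>{1..n}. norm (z i))"
  have Z: "norm (z i) \<le> Z" if "i \<in> {1..n}" for i
    unfolding Z_def using that by (intro member_le_sum) auto
  have Z0: "0 \<le> Z" unfolding Z_def by (intro sum_nonneg) auto
  \<comment> \<open>The summand 1 gives \<open>1 \<le> sqrt (Q t)\<close>, so the constant offsets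
    \<open>z\<close> in the control are absorbed into a multiple of
    \<open>sqrt (Q t)\<close>.\<close>
  define Q where "Q t = 1 + (\<Sum>i\<in>{1..n}. (norm (x i t))\<^sup>2 + (norm (v i t))\<^sup>2)" for t
  define acc where "acc i t = cs_acc n K M \<alpha> \<beta> z (\<lambda>k. x k t) (\<lambda>k. v k t) i" for i t
  define Q' where "Q' t = 0 + (\<Sum>i\<in>{1..n}. 2 * (x i t \<bullet> v i t) + 2 * (v i t \<bullet> acc i t))" for t
  \<comment> \<open>\<open>2 * real n\<close> bounds the contribution of the products of positions
    and velocities. The rest is the power of the control, whose norm is at most
    \<open>(4 + 2 * Z) * sqrt (Q t)\<close>; the interaction contributes nothing positive.\<close>
  define A where "A = 2 * real n + 2 * M * real n * (4 + 2 * Z)"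
  have Q1: "1 \<le> Q t" for t by (auto simp: Q_def intro!: sum_nonneg)
  have le: "norm (x i t) \<le> sqrt (Q t) \<and> norm (v i t) \<le> sqrt (Q t)" if "i \<in> {1..n}" for i t
  proof -
    have "(norm (x i t))\<^sup>2 + (norm (v i t))\<^sup>2 \<le> (\<Sum>i\<in>{1..n}. (norm (x i t))\<^sup>2 + (norm (v i t))\<^sup>2)"
      using that by (intro member_le_sum[where f = "\<lambda>i. (norm (x i t))\<^sup>2 + (norm (v i t))\<^sup>2"]) auto
    then have "(norm (x i t))\<^sup>2 + (norm (v i t))\<^sup>2 \<le> Q t" by (simp add: Q_def)
    then have "(norm (x i t))\<^sup>2 \<le> Q t" "(norm (v i t))\<^sup>2 \<le> Q t"
      using zero_le_power2[of "norm (x i t)"] zero_le_power2[of "norm (v i t)"] by linarith+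
    then show ?thesis by (simp add: real_le_rsqrt)
  qed
  have bound: "Q t \<le> Q 0 * exp (A * t)" if t: "t \<in> {0..<T}" for t
  proof (rule gronwall_on_halfopen[OF _ _ t])
    fix t assume t: "t \<in> {0..<T}"
    show "(Q has_real_derivative Q' t) (at t within {0..<T})"
      unfolding Q_def Q'_def acc_def
      by (intro DERIV_add DERIV_const DERIV_sum has_real_derivative_power2_norm x v t)
    let ?s = "sqrt (Q t)"
    have s: "1 \<le> ?s" "?s * ?s = Q t" using Q1[of t] by auto
    have xv: "x i t \<bullet> v i t \<le> Q t" if "i \<in> {1..n}" for i
    proof -
      have "x i t \<bullet> v i t \<le> norm (x i t) * norm (v i t)" by (rule norm_cauchy_schwarz)
      also have "\<dots> \<le> ?s * ?s" using le[OF that, of t] Q1[of t] by (intro mult_mono) auto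
      finally show ?thesis using s by simp
    qed
    have vu: "v i t \<bullet> control n \<beta> z (\<lambda>k. x k t) i \<le> (4 + 2 * Z) * Q t" if "i \<in> {1..n}" for i
    proof -
      have "norm (control n \<beta> z (\<lambda>k. x k t) i) \<le> 2 * (2 * ?s + Z)"
        using le Z by (intro norm_control_le[OF \<open>0 < \<beta>\<close> \<open>2 \<le> n\<close> that]) auto
      also have "\<dots> \<le> (4 + 2 * Z) * ?s"
        using mult_left_mono[OF s(1) Z0] by (simp add: algebra_simps)
      finally have u: "norm (control n \<beta> z (\<lambda>k. x k t) i) \<le> (4 + 2 * Z) * ?s" .
      have "v i t \<bullet> control n \<beta> z (\<lambda>k. x k t) i \<le> norm (v i t) * norm (control n \<beta> z (\<lambda>k. x k t) i)"
        by (rule norm_cauchy_schwarz)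
      also have "\<dots> \<le> ?s * ((4 + 2 * Z) * ?s)"
        using le[OF that, of t] u Q1[of t] by (intro mult_mono) auto
      also have "\<dots> = (4 + 2 * Z) * (?s * ?s)" by (simp only: mult.left_commute)
      finally show ?thesis using s by simp
    qed
    have "(\<Sum>i\<in>{1..n}. v i t \<bullet> acc i t) = (K / real n) *
        (\<Sum>i\<in>{1..n}. v i t \<bullet> (\<Sum>j\<in>{1..n} - {i}. psi \<alpha> (norm (x j t - x i t)) *\<^sub>R (v j t - v i t)))
        + M * (\<Sum>i\<in>{1..n}. v i t \<bullet> control n \<beta> z (\<lambda>k. x k t) i)"
      by (simp add: acc_def cs_acc_def inner_add_right sum.distrib sum_distrib_left)
    also have "\<dots> \<le> (K / real n) * 0 + M * (\<Sum>i\<in>{1..n}. (4 + 2 * Z) * Q t)"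
      using assms(1-3) vu cs_velocity_dissipation[where x = "\<lambda>k. x k t" and v = "\<lambda>k. v k t"]
      by (intro add_mono mult_left_mono sum_mono) auto
    finally have "(\<Sum>i\<in>{1..n}. v i t \<bullet> acc i t) \<le> M * (real n * ((4 + 2 * Z) * Q t))" by simp
    moreover have "(\<Sum>i\<in>{1..n}. x i t \<bullet> v i t) \<le> real n * Q t"
      using sum_mono[of "{1..n}" "\<lambda>i. x i t \<bullet> v i t" "\<lambda>_. Q t"] xv by simp
    moreover have "Q' t = 2 * (\<Sum>i\<in>{1..n}. x i t \<bullet> v i t) + 2 * (\<Sum>i\<in>{1..n}. v i t \<bullet> acc i t)"
      by (simp add: Q'_def sum.distrib sum_distrib_left)
    ultimately have "Q' t \<le> 2 * (real n * Q t) + 2 * (M * (real n * ((4 + 2 * Z) * Q t)))" by linarith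
    also have "\<dots> = A * Q t" by (simp add: A_def algebra_simps)
    finally show "Q' t \<le> A * Q t" .
  qed
  have A: "0 \<le> A" using assms Z0 by (simp add: A_def)
  show ?thesis
  proof
    show "0 < sqrt (Q 0 * exp (A * T))" using Q1[of 0] by simp
    fix i t assume it: "i \<in> {1..n}" "t \<in> {0..<T}"
    have "Q 0 * exp (A * t) \<le> Q 0 * exp (A * T)"
      using it(2) A Q1[of 0] by (intro mult_left_mono) (auto intro: mult_left_mono)
    then have "sqrt (Q t) \<le> sqrt (Q 0 * exp (A * T))" using bound[OF it(2)] by simp
    then show "norm (x i t) \<le> sqrt (Q 0 * exp (A * T)) \<and> norm (v i t) \<le> sqrt (Q 0 * exp (A * T))"
      using le[OF it(1), of t] by linarith
  qed
qed

section \<open>Exclusion of collisions at a finite time\<close>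

text \<open>The minimum of finitely many thresholds. Here \<open>s\<close> is a pair of particles
  and \<open>e\<close> a lower bound for its distance: initially, near the end time, or on the whole
  interval.\<close>

lemma finite_uniform_eps:
  fixes P :: "'s \<Rightarrow> real \<Rightarrow> bool"
  assumes "finite S" "\<And>s. s \<in> S \<Longrightarrow> \<exists>e>0. P s e"
    and anti: "\<And>s e e'. P s e \<Longrightarrow> 0 < e' \<Longrightarrow> e' \<le> e \<Longrightarrow> P s e'"
  shows "\<exists>e>0. \<forall>s\<in>S. P s e"
  using assms(1,2)
proof (induction S)
  case empty
  then show ?case by (auto intro: exI[of _ 1])
next
  case (insert a S)
  obtain e where e: "e > 0" "\<forall>s\<in>S. P s e" using insert by auto
  obtain e' where e': "e' > 0" "P a e'" using insert.prems[of a] by auto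
  have "\<forall>s\<in>insert a S. P s (min e e')"
  proof
    fix s assume "s \<in> insert a S"
    then show "P s (min e e')"
      using anti[of s e "min e e'"] anti[of s e' "min e e'"] e e' by auto
  qed
  then show ?case using e(1) e'(1) by (intro exI[of _ "min e e'"]) auto
qed

text \<open>The bound makes \<open>x\<close> Lipschitz, hence uniformly continuous, and such a
  function extends to the closure of its domain. This supplies limit positions at time
  \<open>T\<close>.\<close>

lemma continuous_extension_of_bounded_derivative:
  fixes x :: "real \<Rightarrow> 'a::banach"
  assumes x: "\<And>t. t \<in> {0..<T} \<Longrightarrow> (x has_vector_derivative v t) (at t within {0..<T})"
    and v: "\<And>t. t \<in> {0..<T} \<Longrightarrow> norm (v t) \<le> R" and "0 < T" "0 \<le> R"
  obtains g where "continuous_on {0..T} g" "\<And>t. t \<in> {0..<T} \<Longrightarrow> g t = x t"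
    "(x \<longlongrightarrow> g T) (at_left T)"
proof -
  have "R-lipschitz_on {0..<T} x"
  proof (rule lipschitz_onI)
    fix s t assume st: "s \<in> {0..<T}" "t \<in> {0..<T}"
    have "norm (x s - x t) \<le> R * norm (s - t)"
    proof (rule differentiable_bound[of "{0..<T}" x "\<lambda>t h. h *\<^sub>R v t"])
      fix r assume r: "r \<in> {0..<T}"
      show "(x has_derivative (\<lambda>h. h *\<^sub>R v r)) (at r within {0..<T})"
        using x[OF r] by (simp add: has_vector_derivative_def)
      show "onorm (\<lambda>h. h *\<^sub>R v r) \<le> R"
      proof (rule onorm_le)
        fix h :: real
        show "norm (h *\<^sub>R v r) \<le> R * norm h"
          using mult_left_mono[OF v[OF r], of "\<bar>h\<bar>"] by (simp add: mult.commute)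
      qed
    qed (use st in auto)
    then show "dist (x s) (x t) \<le> R * dist s t" by (simp add: dist_norm)
  qed (rule \<open>0 \<le> R\<close>)
  then have "uniformly_continuous_on {0..<T} x" by (rule lipschitz_on_uniformly_continuous)
  then obtain g where g: "uniformly_continuous_on (closure {0..<T}) g" "\<And>t. t \<in> {0..<T} \<Longrightarrow> x t = g t"
    using uniformly_continuous_on_extension_on_closure by metis
  have cont: "continuous_on {0..T} g"
    using uniformly_continuous_imp_continuous[OF g(1)] \<open>0 < T\<close> by simp
  then have "(g \<longlongrightarrow> g T) (at T within {0..T})" using \<open>0 < T\<close> by (simp add: continuous_on)
  then have "(g \<longlongrightarrow> g T) (at_left T)" using \<open>0 < T\<close> by (simp add: at_within_Icc_at_left)
  moreover have "\<forall>\<^sub>F t in at_left T. g t = x t"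
    using eventually_at_left[OF \<open>0 < T\<close>] g(2) \<open>0 < T\<close> by (auto intro!: exI[of _ 0])
  ultimately have "(x \<longlongrightarrow> g T) (at_left T)" by (rule Lim_transform_eventually)
  with cont g(2) show ?thesis by (intro that) auto
qed

lemma cs_no_collision:
  fixes x v :: "nat \<Rightarrow> real \<Rightarrow> real ^ 'd"
  assumes params: "2 \<le> n" "0 < K" "0 \<le> M" "0 < \<beta>" and "1 \<le> \<alpha>" and "0 < T"
    and x: "\<And>i t. i \<in> {1..n} \<Longrightarrow> t \<in> {0..<T} \<Longrightarrow> (x i has_vector_derivative v i t) (at t within {0..<T})"
    and v: "\<And>i t. i \<in> {1..n} \<Longrightarrow> t \<in> {0..<T} \<Longrightarrow>
      (v i has_vector_derivative cs_acc n K M \<alpha> \<beta> z (\<lambda>k. x k t) (\<lambda>k. v k t) i) (at t within {0..<T})"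
    and ne: "\<And>i j t. i \<in> {1..n} \<Longrightarrow> j \<in> {1..n} \<Longrightarrow> i \<noteq> j \<Longrightarrow> t \<in> {0..<T} \<Longrightarrow> x i t \<noteq> x j t"
  obtains \<epsilon> where "\<epsilon> > 0"
    "\<And>i j t. i \<in> {1..n} \<Longrightarrow> j \<in> {1..n} \<Longrightarrow> i \<noteq> j \<Longrightarrow> t \<in> {0..<T} \<Longrightarrow> \<epsilon> \<le> norm (x i t - x j t)"
proof -
  let ?I = "{1..n}"
  obtain R where R: "R > 0"
    "\<And>i t. i \<in> ?I \<Longrightarrow> t \<in> {0..<T} \<Longrightarrow> norm (x i t) \<le> R \<and> norm (v i t) \<le> R"
    using cs_bounded[OF params x v] by metis
  have "\<exists>g. continuous_on {0..T} g \<and> (\<forall>t\<in>{0..<T}. g t = x i t) \<and> (x i \<longlongrightarrow> g T) (at_left T)"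
    if i: "i \<in> ?I" for i
    using continuous_extension_of_bounded_derivative[where x = "x i" and v = "v i" and R = R, OF x[OF i]] R(2)[OF i] \<open>0 < T\<close> R(1)
    by (metis less_imp_le)
  then obtain g where cont: "\<And>i. i \<in> ?I \<Longrightarrow> continuous_on {0..T} (g i)"
    and gx: "\<And>i t. i \<in> ?I \<Longrightarrow> t \<in> {0..<T} \<Longrightarrow> g i t = x i t"
    and lim: "\<And>i. i \<in> ?I \<Longrightarrow> (x i \<longlongrightarrow> g i T) (at_left T)"
    by metis
  have neT: "g p T \<noteq> g q T" if pq: "p \<in> ?I" "q \<in> ?I" "p \<noteq> q" for p q
  proof
    assume eqT: "g p T = g q T"
    \<comment> \<open>All particles with this limit are taken, so each remaining one has a different
      limit and keeps a positive distance \<open>d\<close> from the cluster near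
      \<open>T\<close>.\<close>
    define C where "C = {i \<in> ?I. g i T = g p T}"
    have C: "finite C" "p \<in> C" "q \<in> C" "C \<subseteq> ?I" using pq eqT by (auto simp: C_def)
    define S where "S t = pair_energy C (\<lambda>i. x i t)" for t
    have "(S \<longlongrightarrow> (\<Sum>i\<in>C. \<Sum>j\<in>C. (norm (g i T - g j T))\<^sup>2)) (at_left T)"
      unfolding S_def pair_energy_def using C(4) by (intro tendsto_intros lim) auto
    moreover have "(\<Sum>i\<in>C. \<Sum>j\<in>C. (norm (g i T - g j T))\<^sup>2) = 0"
      by (intro sum.neutral ballI) (simp add: C_def)
    ultimately have S: "(S \<longlongrightarrow> 0) (at_left T)" by simp
    have "\<exists>d>0. \<forall>s\<in>C \<times> (?I - C). \<forall>\<^sub>F t in at_left T. d \<le> norm (x (snd s) t - x (fst s) t)"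
    proof (rule finite_uniform_eps)
      fix s assume "s \<in> C \<times> (?I - C)"
      then obtain i k where s: "s = (i, k)" "i \<in> C" "k \<in> ?I" "k \<notin> C" by auto
      define d where "d = norm (g k T - g i T)"
      have "d > 0" using s by (auto simp: d_def C_def)
      have "((\<lambda>t. norm (x k t - x i t)) \<longlongrightarrow> d) (at_left T)"
        unfolding d_def using s C(4) by (intro tendsto_intros lim) auto
      then have "\<forall>\<^sub>F t in at_left T. d / 2 < norm (x k t - x i t)"
        using \<open>d > 0\<close> by (intro order_tendstoD(1)) auto
      then show "\<exists>d>0. \<forall>\<^sub>F t in at_left T. d \<le> norm (x (snd s) t - x (fst s) t)"
        using \<open>d > 0\<close> s(1) by (intro exI[of _ "d / 2"]) (auto elim: eventually_mono)
    next
      fix s e e'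
      assume "\<forall>\<^sub>F t in at_left T. e \<le> norm (x (snd s) t - x (fst s) t)" "e' \<le> (e :: real)"
      then show "\<forall>\<^sub>F t in at_left T. e' \<le> norm (x (snd s) t - x (fst s) t)"
        by (auto elim: eventually_mono)
    qed (use C(1) in auto)
    then obtain d where d: "d > 0"
      "\<forall>s\<in>C \<times> (?I - C). \<forall>\<^sub>F t in at_left T. d \<le> norm (x (snd s) t - x (fst s) t)" by blast
    then have "\<forall>\<^sub>F t in at_left T. \<forall>s\<in>C \<times> (?I - C). d \<le> norm (x (snd s) t - x (fst s) t)"
      using C(1) by (intro eventually_ball_finite) auto
    moreover have "\<forall>\<^sub>F t in at_left T. S t < 1" using order_tendstoD(2)[OF S] by simp
    ultimately have "\<forall>\<^sub>F t in at_left T. (\<forall>s\<in>C \<times> (?I - C). d \<le> norm (x (snd s) t - x (fst s) t)) \<and> S t < 1"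
      by (rule eventually_conj)
    then obtain b where b: "b < T" "\<And>t. b < t \<Longrightarrow> t < T \<Longrightarrow>
        (\<forall>s\<in>C \<times> (?I - C). d \<le> norm (x (snd s) t - x (fst s) t)) \<and> S t < 1"
      unfolding eventually_at_left[OF \<open>0 < T\<close>] by blast
    define t0 where "t0 = (max 0 b + T) / 2"
    have t0: "0 < t0" "b < t0" "t0 < T" using b(1) \<open>0 < T\<close> by (auto simp: t0_def)
    have sub: "{t0..<T} \<subseteq> {0..<T}" using t0 by auto
    define Z where "Z = (\<Sum>i\<in>?I. norm (z i))"
    have Z: "norm (z i) \<le> Z" if "i \<in> ?I" for i
      unfolding Z_def using that by (intro member_le_sum) auto
    define c where "c = K / real n"
    have c: "0 < c" using params by (simp add: c_def)
    \<comment> \<open>Everything acting on particle \<open>i\<close> from outside the cluster; for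
      the cluster it is a bounded perturbation.\<close>
    define f where "f i t = c *\<^sub>R (\<Sum>j\<in>?I - C. psi \<alpha> (norm (x j t - x i t)) *\<^sub>R (v j t - v i t))
      + M *\<^sub>R control n \<beta> z (\<lambda>k. x k t) i" for i t
    \<comment> \<open>Weights at distance at least \<open>d\<close> are at most
      \<open>d powr - \<alpha>\<close>, velocity differences at most \<open>R + R\<close>; the last
      term is the bound of \<open>norm_control_le\<close>.\<close>
    define B where "B = c * (\<Sum>j\<in>?I - C. d powr - \<alpha> * (R + R)) + M * (2 * (2 * R + Z))"
    obtain \<rho> where \<rho>: "\<rho> > 0" "\<And>t. t \<in> {t0..<T} \<Longrightarrow> \<rho> \<le> S t"
      unfolding S_def
    proof (rule cluster_no_collapse[OF C(1,2,3) pq(3), where x = x and v = v and b = f and B = B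
          and c = c and \<alpha> = \<alpha> and ?t0.0 = t0 and T = T
          and a = "\<lambda>i t. cs_acc n K M \<alpha> \<beta> z (\<lambda>k. x k t) (\<lambda>k. v k t) i"])
      fix i t assume i: "i \<in> C" and t: "t \<in> {t0..<T}"
      have i': "i \<in> ?I" and t': "t \<in> {0..<T}" using i t C(4) sub by auto
      show "(x i has_vector_derivative v i t) (at t within {t0..<T})"
        by (rule has_vector_derivative_within_subset[OF x[OF i' t'] sub])
      show "(v i has_vector_derivative cs_acc n K M \<alpha> \<beta> z (\<lambda>k. x k t) (\<lambda>k. v k t) i) (at t within {t0..<T})"
        by (rule has_vector_derivative_within_subset[OF v[OF i' t'] sub])
      let ?h = "\<lambda>j. psi \<alpha> (norm (x j t - x i t)) *\<^sub>R (v j t - v i t)"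
      have "sum ?h (?I - {i}) = sum ?h ?I"
        by (rule sum.mono_neutral_left) auto
      also have "\<dots> = sum ?h (?I - C) + sum ?h C"
        using C(4) by (intro sum.subset_diff) auto
      finally show "cs_acc n K M \<alpha> \<beta> z (\<lambda>k. x k t) (\<lambda>k. v k t) i = c *\<^sub>R sum ?h C + f i t"
        by (simp add: cs_acc_def f_def c_def scaleR_add_right)
      have "norm (sum ?h (?I - C)) \<le> (\<Sum>j\<in>?I - C. d powr - \<alpha> * (R + R))"
      proof (intro order_trans[OF norm_sum] sum_mono)
        fix j assume j: "j \<in> ?I - C"
        have "d \<le> norm (x j t - x i t)"
          using b(2)[of t] t t0 i j by auto
        then have "psi \<alpha> (norm (x j t - x i t)) \<le> d powr - \<alpha>"
          unfolding psi_def using d(1) \<open>1 \<le> \<alpha>\<close> by (intro powr_mono2') auto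
        moreover have "norm (v j t - v i t) \<le> R + R"
          using norm_triangle_ineq4[of "v j t" "v i t"] R(2)[OF i' t'] R(2)[OF _ t', of j] j by auto
        moreover have "0 \<le> psi \<alpha> (norm (x j t - x i t))" by (simp add: psi_def)
        ultimately show "norm (?h j) \<le> d powr - \<alpha> * (R + R)"
          by (simp only: norm_scaleR abs_of_nonneg) (intro mult_mono; simp)
      qed
      moreover have "norm (control n \<beta> z (\<lambda>k. x k t) i) \<le> 2 * (2 * R + Z)"
        using R(2)[OF _ t'] Z by (intro norm_control_le[OF params(4,1) i']) auto
      ultimately have "norm (c *\<^sub>R sum ?h (?I - C)) + norm (M *\<^sub>R control n \<beta> z (\<lambda>k. x k t) i) \<le> B"
        unfolding B_def norm_scaleR using c params(3) by (intro add_mono) (auto intro: mult_left_mono)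
      then show "norm (f i t) \<le> B"
        unfolding f_def by (rule order_trans[OF norm_triangle_ineq])
    next
      fix i j t assume "i \<in> C" "j \<in> C" "i \<noteq> j" "t \<in> {t0..<T}"
      then show "x i t \<noteq> x j t" using C(4) sub by (intro ne) auto
    next
      fix t assume "t \<in> {t0..<T}"
      then show "pair_energy C (\<lambda>i. x i t) \<le> 1"
        using b(2)[of t] t0 by (simp add: S_def less_imp_le)
    qed (use c \<open>1 \<le> \<alpha>\<close> t0 in auto)
    have "\<forall>\<^sub>F t in at_left T. \<rho> \<le> S t"
      using eventually_at_left[OF \<open>t0 < T\<close>] \<rho>(2) t0 by (auto intro!: exI[of _ t0])
    then have "\<rho> \<le> 0"
      by (rule tendsto_lowerbound[OF S]) (rule trivial_limit_at_left_real)
    with \<rho>(1) show False by simp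
  qed
  \<comment> \<open>With distinct limits, the distance of two extended trajectories is positive on
    the compact interval \<open>{0..T}\<close> and attains its minimum there.\<close>
  have "\<exists>e>0. \<forall>s\<in>{s \<in> ?I \<times> ?I. fst s \<noteq> snd s}. \<forall>t\<in>{0..<T}. e \<le> norm (x (fst s) t - x (snd s) t)"
  proof (rule finite_uniform_eps)
    fix s assume "s \<in> {s \<in> ?I \<times> ?I. fst s \<noteq> snd s}"
    then obtain i j where s: "s = (i, j)" "i \<in> ?I" "j \<in> ?I" "i \<noteq> j" by auto
    have "continuous_on {0..T} (\<lambda>t. norm (g i t - g j t))"
      by (intro continuous_intros cont s)
    then obtain r where r: "r \<in> {0..T}" "\<And>t. t \<in> {0..T} \<Longrightarrow> norm (g i r - g j r) \<le> norm (g i t - g j t)"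
      using continuous_attains_inf[of "{0..T}" "\<lambda>t. norm (g i t - g j t)"] \<open>0 < T\<close> by auto
    have "g i r \<noteq> g j r"
      using neT[OF s(2,3,4)] ne[OF s(2,3,4), of r] gx[OF s(2), of r] gx[OF s(3), of r] r(1)
      by (cases "r = T") auto
    moreover have "norm (g i r - g j r) \<le> norm (x i t - x j t)" if "t \<in> {0..<T}" for t
      using r(2)[of t] gx[OF s(2) that] gx[OF s(3) that] that by simp
    ultimately show "\<exists>e>0. \<forall>t\<in>{0..<T}. e \<le> norm (x (fst s) t - x (snd s) t)"
      using s(1) by (intro exI[of _ "norm (g i r - g j r)"]) auto
  qed auto
  then obtain \<epsilon> where "\<epsilon> > 0"
    "\<forall>s\<in>{s \<in> ?I \<times> ?I. fst s \<noteq> snd s}. \<forall>t\<in>{0..<T}. \<epsilon> \<le> norm (x (fst s) t - x (snd s) t)" by blast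
  then show ?thesis by (intro that[of \<epsilon>]) auto
qed

section \<open>Finite orders of differentiability\<close>

text \<open>\<open>smooth_on\<close> asks for all derivatives at once, which does not fit an
  induction. With finite orders the closure properties and the regularity of solutions are proved
  order by order.\<close>

primrec C_diff :: "nat \<Rightarrow> real set \<Rightarrow> (real \<Rightarrow> 'a::real_normed_vector) \<Rightarrow> bool" where
  "C_diff 0 S f = continuous_on S f"
| "C_diff (Suc k) S f =
     (\<exists>f'. (\<forall>t\<in>S. (f has_vector_derivative f' t) (at t within S)) \<and> C_diff k S f')"

lemma C_diff_SucI:
  "(\<And>t. t \<in> S \<Longrightarrow> (f has_vector_derivative f' t) (at t within S)) \<Longrightarrow> C_diff k S f' \<Longrightarrow>
    C_diff (Suc k) S f"
  by auto

lemma C_diff_SucD: "C_diff (Suc k) S f \<Longrightarrow> C_diff k S f"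
proof (induction k arbitrary: f)
  case 0
  then show ?case by (auto intro: continuous_on_vector_derivative)
next
  case (Suc k)
  then obtain f' where "\<forall>t\<in>S. (f has_vector_derivative f' t) (at t within S)" "C_diff (Suc k) S f'"
    by (auto simp del: C_diff.simps(2) simp: C_diff.simps(2)[of "Suc k"])
  with Suc.IH show ?case unfolding C_diff.simps(2)[of k S f] by blast
qed

lemma C_diff_cong:
  assumes "\<And>t. t \<in> S \<Longrightarrow> f t = g t"
  shows "C_diff k S f \<longleftrightarrow> C_diff k S g"
proof (cases k)
  case 0
  then show ?thesis using assms by (simp cong: continuous_on_cong)
next
  case (Suc m)
  have "(f has_vector_derivative d) (at t within S) \<longleftrightarrow> (g has_vector_derivative d) (at t within S)"
    if "t \<in> S" for t d
    using assms that
    by (auto intro: has_vector_derivative_transform[OF that, of f g] has_vector_derivative_transform[OF that, of g f])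
  then show ?thesis using Suc by simp
qed

lemma C_diff_const: "C_diff k S (\<lambda>t. c)"
proof (induction k arbitrary: c)
  case (Suc k)
  show ?case by (rule C_diff_SucI[OF has_vector_derivative_const Suc])
qed auto

lemma C_diff_add:
  "C_diff k S f \<Longrightarrow> C_diff k S g \<Longrightarrow> C_diff k S (\<lambda>t. f t + g t)"
proof (induction k arbitrary: f g)
  case 0
  then show ?case by (simp add: continuous_on_add)
next
  case (Suc k)
  obtain f' g' where
    *: "\<And>t. t \<in> S \<Longrightarrow> (f has_vector_derivative f' t) (at t within S)" "C_diff k S f'"
    "\<And>t. t \<in> S \<Longrightarrow> (g has_vector_derivative g' t) (at t within S)" "C_diff k S g'"
    using Suc.prems by auto
  show ?case
    by (rule C_diff_SucI[OF has_vector_derivative_add[OF *(1,3)] Suc.IH[OF *(2,4)]])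
qed

lemma C_diff_sum:
  "(\<And>i. i \<in> I \<Longrightarrow> C_diff k S (f i)) \<Longrightarrow> C_diff k S (\<lambda>t. \<Sum>i\<in>I. f i t)"
  by (induction I rule: infinite_finite_induct) (simp_all add: C_diff_const C_diff_add)

lemma C_diff_bilinear:
  assumes "bounded_bilinear p"
  shows "C_diff k S f \<Longrightarrow> C_diff k S g \<Longrightarrow> C_diff k S (\<lambda>t. p (f t) (g t))"
proof (induction k arbitrary: f g)
  case 0
  then show ?case using bounded_bilinear.continuous_on[OF assms] by auto
next
  case (Suc k)
  obtain f' g' where
    *: "\<And>t. t \<in> S \<Longrightarrow> (f has_vector_derivative f' t) (at t within S)" "C_diff k S f'"
    "\<And>t. t \<in> S \<Longrightarrow> (g has_vector_derivative g' t) (at t within S)" "C_diff k S g'"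
    using Suc.prems by auto
  have "C_diff k S (\<lambda>t. p (f t) (g' t) + p (f' t) (g t))"
    by (rule C_diff_add[OF Suc.IH[OF C_diff_SucD[OF Suc.prems(1)] *(4)]
          Suc.IH[OF *(2) C_diff_SucD[OF Suc.prems(2)]]])
  with bounded_bilinear.has_vector_derivative[OF assms *(1,3)] show ?case
    by (rule C_diff_SucI)
qed

lemma C_diff_diff:
  "C_diff k S f \<Longrightarrow> C_diff k S g \<Longrightarrow> C_diff k S (\<lambda>t. f t - g t)"
  using C_diff_add[of k S f "\<lambda>t. (-1) *\<^sub>R g t"]
    C_diff_bilinear[OF bounded_bilinear_scaleR C_diff_const[of k S "-1"], of g] by simp

lemma C_diff_scaleR:
  "C_diff k S f \<Longrightarrow> C_diff k S g \<Longrightarrow> C_diff k S (\<lambda>t. f t *\<^sub>R g t)"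
  by (rule C_diff_bilinear[OF bounded_bilinear_scaleR])

lemma C_diff_power2_norm:
  fixes f :: "real \<Rightarrow> 'a::real_inner"
  shows "C_diff k S f \<Longrightarrow> C_diff k S (\<lambda>t. (norm (f t))\<^sup>2)"
  unfolding power2_norm_eq_inner by (rule C_diff_bilinear[OF bounded_bilinear_inner])

text \<open>The exponent is generalised in the induction because differentiation lowers it by one;
  positivity of \<open>f\<close> keeps every exponent admissible.\<close>

lemma C_diff_powr:
  fixes f :: "real \<Rightarrow> real"
  assumes pos: "\<And>t. t \<in> S \<Longrightarrow> f t > 0"
  shows "C_diff k S f \<Longrightarrow> C_diff k S (\<lambda>t. f t powr a)"
proof (induction k arbitrary: a)
  case 0
  moreover have "\<forall>t\<in>S. f t \<noteq> 0" using pos by (metis less_irrefl)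
  ultimately show ?case by (simp add: continuous_on_powr)
next
  case (Suc k)
  obtain f' where
    *: "\<And>t. t \<in> S \<Longrightarrow> (f has_vector_derivative f' t) (at t within S)" "C_diff k S f'"
    using Suc.prems by auto
  have "((\<lambda>t. f t powr a) has_vector_derivative (a * f t powr (a - 1)) * f' t) (at t within S)"
    if "t \<in> S" for t
  proof -
    have "((\<lambda>z. z powr a) has_real_derivative a * f t powr (a - 1)) (at (f t))"
      by (rule has_real_derivative_powr[OF pos[OF that]])
    moreover have "(f has_real_derivative f' t) (at t within S)"
      using *(1)[OF that] by (simp add: has_real_derivative_iff_has_vector_derivative)
    ultimately have "((\<lambda>t. f t powr a) has_real_derivative a * f t powr (a - 1) * f' t) (at t within S)"
      by (rule DERIV_chain2)
    then show ?thesis by (simp add: has_real_derivative_iff_has_vector_derivative)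
  qed
  moreover have "C_diff k S (\<lambda>t. (a * f t powr (a - 1)) * f' t)"
    by (rule C_diff_bilinear[OF bounded_bilinear_mult C_diff_bilinear[OF bounded_bilinear_mult C_diff_const Suc.IH[OF C_diff_SucD[OF Suc.prems]]] *(2)])
  ultimately show ?case by (rule C_diff_SucI)
qed

text \<open>For each order \<open>C_diff\<close> provides its own witnesses. Derivatives within
  \<open>{0..}\<close> are unique, also at time zero, so all witnesses agree with the iterated
  \<open>vector_derivative\<close>, which gives one sequence for all orders.\<close>

lemma smooth_on_if_C_diff:
  fixes f :: "real \<Rightarrow> 'a::real_normed_vector"
  assumes f: "\<And>k. C_diff k {0..} f"
  shows "smooth_on {0..} f"
proof -
  define D where "D k = ((\<lambda>g t. vector_derivative g (at t within {0..})) ^^ k) f" for k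
  have bot: "at t within {0..} \<noteq> bot" if "0 \<le> t" for t :: real
  proof -
    have "at_right t \<le> at t within {0..}" using that by (intro at_le) auto
    then show ?thesis using trivial_limit_at_right_real[of t] by (auto simp: bot_unique)
  qed
  have "(\<forall>t\<in>{0..}. (D k has_vector_derivative D (Suc k) t) (at t within {0..})) \<and> (\<forall>m. C_diff m {0..} (D (Suc k)))"
    if D: "\<And>m. C_diff m {0..} (D k)" for k
  proof -
    have eq: "D (Suc k) t = f' t"
      if "\<forall>t\<in>{0..}. (D k has_vector_derivative f' t) (at t within {0..})" "0 \<le> t" for f' t
      using that bot unfolding D_def by (auto intro!: vector_derivative_within)
    have "C_diff m {0..} (D (Suc k))" for m
    proof -
      obtain f' where "\<forall>t\<in>{0..}. (D k has_vector_derivative f' t) (at t within {0..})" "C_diff m {0..} f'"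
        using D[of "Suc m"] by auto
      with eq show ?thesis by (subst C_diff_cong[where g = f']) auto
    qed
    moreover have "\<forall>t\<in>{0..}. (D k has_vector_derivative D (Suc k) t) (at t within {0..})"
      using D[of 1] eq by auto
    ultimately show ?thesis by blast
  qed
  moreover have "\<forall>m. C_diff m {0..} (D k)" for k
  proof (induction k)
    case 0
    then show ?case using f by (simp add: D_def)
  qed (use calculation in blast)
  moreover have "D 0 = f" by (simp add: D_def)
  ultimately show ?thesis unfolding smooth_on_def by blast
qed

text \<open>The squared norm is bilinear in its argument, so its regularity follows from the product
  rule; halving the exponent avoids differentiating the norm.\<close>

lemma psi_norm_eq: "w \<noteq> 0 \<Longrightarrow> psi \<alpha> (norm w) = (norm w)\<^sup>2 powr (- \<alpha> / 2)"
  using powr_powr[of "norm w" 2 "- \<alpha> / 2"] by (simp add: psi_def powr_numeral)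

lemma C_diff_link_force:
  fixes x :: "nat \<Rightarrow> real \<Rightarrow> real ^ 'd"
  assumes "C_diff k S (x i)" "C_diff k S (x (i + 1))"
  shows "C_diff k S (\<lambda>t. link_force \<beta> z (\<lambda>l. x l t) i)"
proof -
  have w: "C_diff k S (\<lambda>t. x i t - x (i + 1) t - z i)"
    by (intro C_diff_diff C_diff_const assms)
  have "C_diff k S (\<lambda>t. (1 + (norm (x i t - x (i + 1) t - z i))\<^sup>2) powr (- \<beta>))"
  proof (rule C_diff_powr)
    show "0 < 1 + (norm (x i t - x (i + 1) t - z i))\<^sup>2" for t by (simp add: add_pos_nonneg)
    show "C_diff k S (\<lambda>t. 1 + (norm (x i t - x (i + 1) t - z i))\<^sup>2)"
      by (rule C_diff_add[OF C_diff_const C_diff_power2_norm[OF w]])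
  qed
  then show ?thesis
    unfolding link_force_def phi_def by (rule C_diff_scaleR[OF _ w])
qed

lemma C_diff_cs_acc:
  fixes x v :: "nat \<Rightarrow> real \<Rightarrow> real ^ 'd"
  assumes x: "\<And>i. i \<in> {1..n} \<Longrightarrow> C_diff k S (x i)" and v: "\<And>i. i \<in> {1..n} \<Longrightarrow> C_diff k S (v i)"
    and ne: "\<And>i j t. i \<in> {1..n} \<Longrightarrow> j \<in> {1..n} \<Longrightarrow> i \<noteq> j \<Longrightarrow> t \<in> S \<Longrightarrow> x i t \<noteq> x j t"
    and i: "i \<in> {1..n}" and "2 \<le> n"
  shows "C_diff k S (\<lambda>t. cs_acc n K M \<alpha> \<beta> z (\<lambda>l. x l t) (\<lambda>l. v l t) i)"
proof -
  have "C_diff k S (\<lambda>t. psi \<alpha> (norm (x j t - x i t)) *\<^sub>R (v j t - v i t))" if j: "j \<in> {1..n} - {i}" for j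
  proof (rule C_diff_scaleR)
    have "C_diff k S (\<lambda>t. (norm (x j t - x i t))\<^sup>2 powr (- \<alpha> / 2))"
    proof (rule C_diff_powr)
      show "0 < (norm (x j t - x i t))\<^sup>2" if "t \<in> S" for t
        using ne[of j i t] that i j by auto
      show "C_diff k S (\<lambda>t. (norm (x j t - x i t))\<^sup>2)"
        using i j by (intro C_diff_power2_norm C_diff_diff x) auto
    qed
    moreover have "psi \<alpha> (norm (x j t - x i t)) = (norm (x j t - x i t))\<^sup>2 powr (- \<alpha> / 2)" if "t \<in> S" for t
      using ne[of j i t] that i j by (intro psi_norm_eq) auto
    ultimately show "C_diff k S (\<lambda>t. psi \<alpha> (norm (x j t - x i t)))"
      by (subst C_diff_cong[where g = "\<lambda>t. (norm (x j t - x i t))\<^sup>2 powr (- \<alpha> / 2)"])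
    show "C_diff k S (\<lambda>t. v j t - v i t)"
      using i j by (intro C_diff_diff v) auto
  qed
  then have "C_diff k S (\<lambda>t. (K / real n) *\<^sub>R
      (\<Sum>j\<in>{1..n} - {i}. psi \<alpha> (norm (x j t - x i t)) *\<^sub>R (v j t - v i t)))"
    by (intro C_diff_scaleR[OF C_diff_const] C_diff_sum)
  moreover have link: "C_diff k S (\<lambda>t. link_force \<beta> z (\<lambda>l. x l t) j)" if "1 \<le> j" "j + 1 \<le> n" for j
    using that by (intro C_diff_link_force x) auto
  have "C_diff k S (\<lambda>t. control n \<beta> z (\<lambda>l. x l t) i)"
  proof -
    consider "i = 1" | "i \<noteq> 1" "i = n" | "i \<noteq> 1" "i \<noteq> n" by blast
    then show ?thesis
    proof cases
      case 1
      then show ?thesis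
        using C_diff_diff[OF C_diff_const[of k S 0] link[of 1]] \<open>2 \<le> n\<close> by (simp add: control_def)
    next
      case 2
      then show ?thesis
        using link[of "n - 1"] \<open>2 \<le> n\<close> by (simp add: control_def)
    next
      case 3
      have "C_diff k S (\<lambda>t. link_force \<beta> z (\<lambda>l. x l t) (i - 1) - link_force \<beta> z (\<lambda>l. x l t) i)"
        using 3 i by (intro C_diff_diff link) auto
      with 3 show ?thesis by (simp add: control_def)
    qed
  qed
  then have "C_diff k S (\<lambda>t. M *\<^sub>R control n \<beta> z (\<lambda>l. x l t) i)"
    by (rule C_diff_scaleR[OF C_diff_const])
  ultimately show ?thesis unfolding cs_acc_def by (rule C_diff_add)
qed

text \<open>Bootstrapping: if positions and velocities have order \<open>k\<close>, so has the
  acceleration away from collisions, and integrating the equations raises the order by one.\<close>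

lemma cs_smooth:
  fixes x v :: "nat \<Rightarrow> real \<Rightarrow> real ^ 'd"
  assumes "2 \<le> n"
    and x: "\<And>i t. i \<in> {1..n} \<Longrightarrow> 0 \<le> t \<Longrightarrow> (x i has_vector_derivative v i t) (at t within {0..})"
    and v: "\<And>i t. i \<in> {1..n} \<Longrightarrow> 0 \<le> t \<Longrightarrow>
      (v i has_vector_derivative cs_acc n K M \<alpha> \<beta> z (\<lambda>k. x k t) (\<lambda>k. v k t) i) (at t within {0..})"
    and ne: "\<And>i j t. i \<in> {1..n} \<Longrightarrow> j \<in> {1..n} \<Longrightarrow> i \<noteq> j \<Longrightarrow> 0 \<le> t \<Longrightarrow> x i t \<noteq> x j t"
    and i: "i \<in> {1..n}"
  shows "smooth_on {0..} (x i)" "smooth_on {0..} (v i)"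
proof -
  have *: "\<forall>i\<in>{1..n}. C_diff k {0..} (x i) \<and> C_diff k {0..} (v i)" for k
  proof (induction k)
    case 0
    have "continuous_on {0..} (x i)" if "i \<in> {1..n}" for i
      by (rule continuous_on_vector_derivative) (use x[OF that] in auto)
    moreover have "continuous_on {0..} (v i)" if "i \<in> {1..n}" for i
      by (rule continuous_on_vector_derivative) (use v[OF that] in auto)
    ultimately show ?case by simp
  next
    case (Suc k)
    have "C_diff k {0..} (\<lambda>t. cs_acc n K M \<alpha> \<beta> z (\<lambda>l. x l t) (\<lambda>l. v l t) i)" if "i \<in> {1..n}" for i
      using Suc.IH ne that \<open>2 \<le> n\<close> by (intro C_diff_cs_acc) auto
    then have "C_diff (Suc k) {0..} (v i)" if "i \<in> {1..n}" for i
      by (rule C_diff_SucI[rotated]) (use v that in auto)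
    moreover have "C_diff (Suc k) {0..} (x i)" if "i \<in> {1..n}" for i
      by (rule C_diff_SucI[of _ _ "v i"]) (use x Suc.IH that in auto)
    ultimately show ?case by blast
  qed
  show "smooth_on {0..} (x i)" "smooth_on {0..} (v i)"
    using * i by (auto intro!: smooth_on_if_C_diff)
qed

section \<open>Truncated vector fields\<close>

lemma lipschitz_on_comp_UNIV:
  assumes "L-lipschitz_on UNIV g" "N-lipschitz_on S f"
  shows "(L * N)-lipschitz_on S (\<lambda>y. g (f y))"
  by (rule lipschitz_on_compose2[OF assms(2) lipschitz_on_subset[OF assms(1) subset_UNIV]])

text \<open>The reason for truncating velocities as well as distances: the product estimate needs
  bounds on both factors, and the distance cutoff bounds only the weight.\<close>

lemma lipschitz_on_scaleR_bounded:
  fixes f :: "'a::metric_space \<Rightarrow> real" and g :: "'a \<Rightarrow> 'b::real_normed_vector"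
  assumes f: "L-lipschitz_on S f" "\<And>y. y \<in> S \<Longrightarrow> \<bar>f y\<bar> \<le> A"
    and g: "N-lipschitz_on S g" "\<And>y. y \<in> S \<Longrightarrow> norm (g y) \<le> B" and "0 \<le> A" "0 \<le> B"
  shows "(L * B + A * N)-lipschitz_on S (\<lambda>y. f y *\<^sub>R g y)"
proof (rule lipschitz_onI)
  have L: "0 \<le> L" "0 \<le> N" using f(1) g(1) by (auto dest: lipschitz_on_nonneg)
  then show "0 \<le> L * B + A * N" using assms by simp
  fix y y' assume S: "y \<in> S" "y' \<in> S"
  have "norm (f y *\<^sub>R g y - f y' *\<^sub>R g y') = norm ((f y - f y') *\<^sub>R g y + f y' *\<^sub>R (g y - g y'))"
    by (simp add: algebra_simps)
  also have "\<dots> \<le> \<bar>f y - f y'\<bar> * norm (g y) + \<bar>f y'\<bar> * norm (g y - g y')"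
    by (rule order_trans[OF norm_triangle_ineq]) simp
  also have "\<dots> \<le> (L * dist y y') * B + A * (N * dist y y')"
    using lipschitz_onD[OF f(1) S] lipschitz_onD[OF g(1) S] f(2) g(2) S assms L
    by (intro add_mono mult_mono) (auto simp: dist_norm)
  finally show "dist (f y *\<^sub>R g y) (f y' *\<^sub>R g y') \<le> (L * B + A * N) * dist y y'"
    by (simp add: dist_norm algebra_simps)
qed

lemma lipschitz_on_sum_ex:
  fixes f :: "'i \<Rightarrow> 'a::metric_space \<Rightarrow> 'b::real_normed_vector"
  assumes "\<And>i. i \<in> I \<Longrightarrow> \<exists>L. L-lipschitz_on S (f i)"
  shows "\<exists>L. L-lipschitz_on S (\<lambda>y. \<Sum>i\<in>I. f i y)"
  using assms
proof (induction I rule: infinite_finite_induct)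
  case (insert a I)
  obtain L where "L-lipschitz_on S (f a)" using insert.prems by blast
  moreover obtain N where "N-lipschitz_on S (\<lambda>y. \<Sum>i\<in>I. f i y)"
    using insert.IH insert.prems by blast
  ultimately have "(L + N)-lipschitz_on S (\<lambda>y. f a y + (\<Sum>i\<in>I. f i y))" by (rule lipschitz_on_add)
  then show ?case using insert.hyps by (intro exI[of _ "L + N"]) simp
qed (use lipschitz_on_constant[of S "0 :: 'b"] in \<open>auto intro!: exI[of _ 0]\<close>)

lemma lipschitz_on_uniform_ex:
  assumes "finite I" "\<And>i. i \<in> I \<Longrightarrow> \<exists>L. L-lipschitz_on S (f i)"
  shows "\<exists>L. \<forall>i\<in>I. L-lipschitz_on S (f i)"
  using assms
proof (induction I)
  case (insert a I)
  obtain L where L: "L-lipschitz_on S (f a)" using insert.prems by blast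
  obtain N where N: "\<forall>i\<in>I. N-lipschitz_on S (f i)" using insert.IH insert.prems by blast
  have "(max L N)-lipschitz_on S (f i)" if "i \<in> insert a I" for i
  proof (cases "i = a")
    case True
    then show ?thesis using lipschitz_on_le[OF L, of "max L N"] by simp
  next
    case False
    then show ?thesis using that N lipschitz_on_le[of N S "f i" "max L N"] by simp
  qed
  then show ?case by blast
qed simp

text \<open>The constant is the absolute value of the derivative at \<open>\<epsilon>\<close>, its
  maximum on \<open>{\<epsilon>..}\<close>; the map \<open>max \<epsilon>\<close> does not increase
  distances.\<close>

lemma lipschitz_psi_max:
  assumes "0 < \<epsilon>" "0 < \<alpha>"
  shows "(\<alpha> * \<epsilon> powr (- \<alpha> - 1))-lipschitz_on UNIV (\<lambda>r. psi \<alpha> (max \<epsilon> r))"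
proof (rule lipschitz_onI)
  fix r s :: real
  have "norm (max \<epsilon> r powr - \<alpha> - max \<epsilon> s powr - \<alpha>) \<le> \<alpha> * \<epsilon> powr (- \<alpha> - 1) * norm (max \<epsilon> r - max \<epsilon> s)"
  proof (rule field_differentiable_bound[where S = "{\<epsilon>..}" and f' = "\<lambda>q. - \<alpha> * q powr (- \<alpha> - 1)"])
    fix q assume q: "q \<in> {\<epsilon>..}"
    then have "0 < q" using assms by auto
    then show "((\<lambda>q. q powr - \<alpha>) has_field_derivative - \<alpha> * q powr (- \<alpha> - 1)) (at q within {\<epsilon>..})"
      by (rule has_field_derivative_at_within[OF has_real_derivative_powr])
    have "q powr (- \<alpha> - 1) \<le> \<epsilon> powr (- \<alpha> - 1)"
      using q assms by (intro powr_mono2') auto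
    then show "norm (- \<alpha> * q powr (- \<alpha> - 1)) \<le> \<alpha> * \<epsilon> powr (- \<alpha> - 1)"
      using assms by (simp add: abs_mult)
  qed auto
  also have "\<dots> \<le> \<alpha> * \<epsilon> powr (- \<alpha> - 1) * norm (r - s)"
    using assms by (intro mult_left_mono) auto
  finally show "dist (psi \<alpha> (max \<epsilon> r)) (psi \<alpha> (max \<epsilon> s)) \<le> \<alpha> * \<epsilon> powr (- \<alpha> - 1) * dist r s"
    by (simp add: dist_norm psi_def)
qed (use assms in auto)

text \<open>In the derivative, 1 bounds \<open>phi\<close>, and \<open>2 * \<beta>\<close> bounds
  the term from differentiating \<open>phi\<close>, where the growth of
  \<open>(norm q)\<^sup>2\<close> is offset by one power of \<open>1 + q \<bullet> q\<close>. Thus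
  the control can be kept without a cutoff.\<close>

lemma lipschitz_phi_field:
  assumes "0 < \<beta>"
  shows "(1 + 2 * \<beta>)-lipschitz_on UNIV (\<lambda>s :: 'a::euclidean_space. phi \<beta> ((norm s)\<^sup>2) *\<^sub>R s)"
proof (rule lipschitz_onI)
  fix s r :: 'a
  have "norm (phi \<beta> ((norm s)\<^sup>2) *\<^sub>R s - phi \<beta> ((norm r)\<^sup>2) *\<^sub>R r) \<le> (1 + 2 * \<beta>) * norm (s - r)"
  proof (rule differentiable_bound[of UNIV])
    fix q :: 'a
    let ?N = "1 + q \<bullet> q"
    let ?D = "\<lambda>h. phi \<beta> (q \<bullet> q) *\<^sub>R h + ((q \<bullet> h + h \<bullet> q) * (- \<beta> * ?N powr (- \<beta> - 1))) *\<^sub>R q"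
    have N: "1 \<le> ?N" and N0: "0 < ?N" by (simp_all add: add_pos_nonneg)
    have "((\<lambda>s. 1 + s \<bullet> s) has_derivative (\<lambda>h. q \<bullet> h + h \<bullet> q)) (at q)"
      by (auto intro!: derivative_eq_intros)
    then have "((\<lambda>s. phi \<beta> (s \<bullet> s)) has_derivative (\<lambda>h. (q \<bullet> h + h \<bullet> q) * (- \<beta> * ?N powr (- \<beta> - 1)))) (at q)"
      unfolding phi_def using N0
      by (intro DERIV_compose_FDERIV[where f = "\<lambda>x. x powr - \<beta>"] has_real_derivative_powr) auto
    from has_derivative_scaleR[OF this has_derivative_ident]
    show "((\<lambda>s. phi \<beta> ((norm s)\<^sup>2) *\<^sub>R s) has_derivative ?D) (at q within UNIV)"
      by (simp add: power2_norm_eq_inner)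
    show "onorm ?D \<le> 1 + 2 * \<beta>"
    proof (rule onorm_le)
      fix h
      have "?N powr (- \<beta> - 1) = phi \<beta> (q \<bullet> q) / ?N"
        using N by (simp add: phi_def powr_diff)
      also have "\<dots> \<le> 1 / ?N"
        using phi_bounds[OF assms, of "q \<bullet> q"] N by (intro divide_right_mono) auto
      finally have "?N powr (- \<beta> - 1) * (norm q)\<^sup>2 \<le> 1 / ?N * (norm q)\<^sup>2"
        by (rule mult_right_mono) simp
      also have "\<dots> \<le> 1" using N0 by (simp add: power2_norm_eq_inner divide_le_eq)
      finally have *: "?N powr (- \<beta> - 1) * (norm q)\<^sup>2 \<le> 1" .
      have "norm (?D h) \<le> norm (phi \<beta> (q \<bullet> q) *\<^sub>R h)
          + norm (((q \<bullet> h + h \<bullet> q) * (- \<beta> * ?N powr (- \<beta> - 1))) *\<^sub>R q)"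
        by (rule norm_triangle_ineq)
      also have "norm (phi \<beta> (q \<bullet> q) *\<^sub>R h) \<le> 1 * norm h"
        unfolding norm_scaleR using phi_bounds[OF assms, of "q \<bullet> q"] by (intro mult_right_mono) auto
      also have "norm (((q \<bullet> h + h \<bullet> q) * (- \<beta> * ?N powr (- \<beta> - 1))) *\<^sub>R q)
          = 2 * \<beta> * (\<bar>q \<bullet> h\<bar> * (?N powr (- \<beta> - 1) * norm q))"
        using assms by (simp add: abs_mult inner_commute)
      also have "\<dots> \<le> 2 * \<beta> * ((norm q * norm h) * (?N powr (- \<beta> - 1) * norm q))"
        using assms Cauchy_Schwarz_ineq2[of q h] by (intro mult_left_mono mult_right_mono) auto
      also have "\<dots> = 2 * \<beta> * (norm h * (?N powr (- \<beta> - 1) * (norm q)\<^sup>2))"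
        by (simp add: power2_eq_square)
      also have "\<dots> \<le> 2 * \<beta> * (norm h * 1)"
        using assms * by (intro mult_left_mono) auto
      finally show "norm (?D h) \<le> (1 + 2 * \<beta>) * norm h" by (simp add: algebra_simps)
    qed
  qed auto
  then show "dist (phi \<beta> ((norm s)\<^sup>2) *\<^sub>R s) (phi \<beta> ((norm r)\<^sup>2) *\<^sub>R r) \<le> (1 + 2 * \<beta>) * dist s r"
    by (simp add: dist_norm)
qed (use assms in auto)

lemma lipschitz_control:
  fixes x :: "nat \<Rightarrow> 'e::metric_space \<Rightarrow> real ^ 'd"
  assumes "0 < \<beta>" and x: "\<And>i. \<exists>L. L-lipschitz_on S (x i)"
  shows "\<exists>L. L-lipschitz_on S (\<lambda>y. control n \<beta> z (\<lambda>l. x l y) i)"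
proof -
  have link: "\<exists>L. L-lipschitz_on S (\<lambda>y. link_force \<beta> z (\<lambda>l. x l y) j)" for j
  proof -
    obtain L N where "L-lipschitz_on S (x j)" "N-lipschitz_on S (x (j + 1))" using x by meson
    then have "((L + N) + 0)-lipschitz_on S (\<lambda>y. x j y - x (j + 1) y - z j)"
      by (intro lipschitz_on_diff lipschitz_on_constant)
    from lipschitz_on_comp_UNIV[OF lipschitz_phi_field[OF \<open>0 < \<beta>\<close>] this]
    show ?thesis unfolding link_force_def by blast
  qed
  obtain L1 L2 L3 L4 where
    L1: "L1-lipschitz_on S (\<lambda>y. link_force \<beta> z (\<lambda>l. x l y) 1)" and
    L2: "L2-lipschitz_on S (\<lambda>y. link_force \<beta> z (\<lambda>l. x l y) (n - 1))" and
    L3: "L3-lipschitz_on S (\<lambda>y. link_force \<beta> z (\<lambda>l. x l y) (i - 1))" and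
    L4: "L4-lipschitz_on S (\<lambda>y. link_force \<beta> z (\<lambda>l. x l y) i)"
    using link by metis
  consider "i = 1" | "i \<noteq> 1" "i = n" | "i \<noteq> 1" "i \<noteq> n" by blast
  then show ?thesis
  proof cases
    case 1
    with lipschitz_on_minus[OF L1] show ?thesis by (auto simp: control_def)
  next
    case 2
    with L2 show ?thesis by (auto simp: control_def)
  next
    case 3
    with lipschitz_on_diff[OF L3 L4] show ?thesis by (auto simp: control_def)
  qed
qed

text \<open>Projection onto the ball is the velocity cutoff: it is 1-Lipschitz, bounded by
  \<open>R\<close>, and the identity on the ball.\<close>

definition truncated_cs_acc ::
    "real \<Rightarrow> real \<Rightarrow> nat \<Rightarrow> real \<Rightarrow> real \<Rightarrow> real \<Rightarrow> real \<Rightarrow> (nat \<Rightarrow> real ^ 'd) \<Rightarrow>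
     (nat \<Rightarrow> real ^ 'd) \<Rightarrow> (nat \<Rightarrow> real ^ 'd) \<Rightarrow> nat \<Rightarrow> real ^ 'd" where
  "truncated_cs_acc \<epsilon> R n K M \<alpha> \<beta> z x v i =
     (K / real n) *\<^sub>R (\<Sum>j\<in>{1..n} - {i}. psi \<alpha> (max \<epsilon> (norm (x j - x i))) *\<^sub>R
       (closest_point (cball 0 R) (v j) - closest_point (cball 0 R) (v i)))
     + M *\<^sub>R control n \<beta> z x i"

lemma truncated_cs_acc_eq:
  assumes "\<And>i. i \<in> {1..n} \<Longrightarrow> norm (v i) \<le> R"
    and "\<And>i j. i \<in> {1..n} \<Longrightarrow> j \<in> {1..n} \<Longrightarrow> i \<noteq> j \<Longrightarrow> \<epsilon> \<le> norm (x i - x j)" and "i \<in> {1..n}"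
  shows "truncated_cs_acc \<epsilon> R n K M \<alpha> \<beta> z x v i = cs_acc n K M \<alpha> \<beta> z x v i"
proof -
  have "max \<epsilon> (norm (x j - x i)) = norm (x j - x i)" "closest_point (cball 0 R) (v j) = v j"
    if "j \<in> {1..n} - {i}" for j
    using assms(1)[of j] assms(2)[of j i] assms(3) that by (simp_all add: closest_point_self)
  moreover have "closest_point (cball 0 R) (v i) = v i"
    using assms(1)[OF assms(3)] by (simp add: closest_point_self)
  ultimately show ?thesis by (simp add: truncated_cs_acc_def cs_acc_def)
qed

lemma lipschitz_truncated_cs_acc:
  fixes x v :: "nat \<Rightarrow> 'e::metric_space \<Rightarrow> real ^ 'd"
  assumes "0 < \<epsilon>" "0 < \<alpha>" "0 < \<beta>" "0 \<le> R"
    and x: "\<And>i. \<exists>L. L-lipschitz_on S (x i)" and v: "\<And>i. \<exists>L. L-lipschitz_on S (v i)"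
  shows "\<exists>L. L-lipschitz_on S (\<lambda>y. truncated_cs_acc \<epsilon> R n K M \<alpha> \<beta> z (\<lambda>l. x l y) (\<lambda>l. v l y) i)"
proof -
  let ?P = "closest_point (cball (0 :: real ^ 'd) R)"
  have P: "1-lipschitz_on UNIV ?P"
    using closest_point_lipschitz[of "cball (0 :: real ^ 'd) R"] \<open>0 \<le> R\<close> by (intro lipschitz_onI) auto
  have normP: "norm (?P w) \<le> R" for w
    using closest_point_in_set[of "cball (0 :: real ^ 'd) R" w] \<open>0 \<le> R\<close> by auto
  have term_lip: "\<exists>L. L-lipschitz_on S (\<lambda>y. psi \<alpha> (max \<epsilon> (norm (x j y - x i y))) *\<^sub>R (?P (v j y) - ?P (v i y)))" for j
  proof -
    obtain A B where "A-lipschitz_on S (x j)" "B-lipschitz_on S (x i)" using x by meson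
    then have "(A + B)-lipschitz_on S (\<lambda>y. x j y - x i y)" by (rule lipschitz_on_diff)
    moreover have "1-lipschitz_on UNIV (norm :: real ^ 'd \<Rightarrow> real)"
      by (intro lipschitz_onI) (auto simp: dist_norm norm_triangle_ineq3)
    ultimately have "(1 * (A + B))-lipschitz_on S (\<lambda>y. norm (x j y - x i y))"
      by (intro lipschitz_on_comp_UNIV[where g = norm])
    from lipschitz_on_comp_UNIV[OF lipschitz_psi_max[OF assms(1,2)] this]
    obtain C where C: "C-lipschitz_on S (\<lambda>y. psi \<alpha> (max \<epsilon> (norm (x j y - x i y))))" by blast
    have bound: "\<bar>psi \<alpha> (max \<epsilon> r)\<bar> \<le> \<epsilon> powr - \<alpha>" for r
      unfolding psi_def using assms by (auto intro!: powr_mono2')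
    obtain D where D: "D-lipschitz_on S (\<lambda>y. ?P (v j y) - ?P (v i y))"
    proof -
      have "\<exists>L. L-lipschitz_on S (\<lambda>y. ?P (v j y))" for j
        using v[of j] lipschitz_on_comp_UNIV[OF P] by blast
      then obtain A B where "A-lipschitz_on S (\<lambda>y. ?P (v j y))" "B-lipschitz_on S (\<lambda>y. ?P (v i y))"
        by metis
      then have "(A + B)-lipschitz_on S (\<lambda>y. ?P (v j y) - ?P (v i y))" by (rule lipschitz_on_diff)
      then show ?thesis by (rule that)
    qed
    have "norm (?P w - ?P w') \<le> R + R" for w w'
      using norm_triangle_ineq4[of "?P w" "?P w'"] normP[of w] normP[of w'] by simp
    from lipschitz_on_scaleR_bounded[OF C bound D this] \<open>0 \<le> R\<close> show ?thesis by auto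
  qed
  then have "\<exists>L. L-lipschitz_on S (\<lambda>y. \<Sum>j\<in>{1..n} - {i}.
      psi \<alpha> (max \<epsilon> (norm (x j y - x i y))) *\<^sub>R (?P (v j y) - ?P (v i y)))"
    by (rule lipschitz_on_sum_ex)
  then obtain A where A: "A-lipschitz_on S (\<lambda>y. \<Sum>j\<in>{1..n} - {i}.
      psi \<alpha> (max \<epsilon> (norm (x j y - x i y))) *\<^sub>R (?P (v j y) - ?P (v i y)))" ..
  obtain B where B: "B-lipschitz_on S (\<lambda>y. control n \<beta> z (\<lambda>l. x l y) i)"
    using lipschitz_control[where x = x, OF \<open>0 < \<beta>\<close> x] by blast
  from lipschitz_on_add[OF lipschitz_on_cmult[OF A, of "K / real n"] lipschitz_on_cmult[OF B, of M]]
  show ?thesis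
    unfolding truncated_cs_acc_def by blast
qed

section \<open>The state space\<close>

text \<open>
  The number of particles is a term, so the states form a space of bounded sequences, of which only
  the entries in \<open>{1..n}\<close> matter. The index type is a discrete copy of \<open>nat\<close> because \<open>nat\<close> itself is
  not an instance of \<open>metric_space\<close>, which the completeness of \<open>bcontfun\<close> requires.
\<close>

type_synonym 'd state = "(nat discrete \<Rightarrow>\<^sub>C (real ^ 'd)) \<times> (nat discrete \<Rightarrow>\<^sub>C (real ^ 'd))"

abbreviation pos :: "'d::finite state \<Rightarrow> nat \<Rightarrow> real ^ 'd" where
  "pos y \<equiv> \<lambda>i. apply_bcontfun (fst y) (discrete i)"

abbreviation vel :: "'d::finite state \<Rightarrow> nat \<Rightarrow> real ^ 'd" where
  "vel y \<equiv> \<lambda>i. apply_bcontfun (snd y) (discrete i)"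

lemma of_discrete_discrete [simp]: "of_discrete (discrete i) = i"
  by (simp add: discrete_inverse)

definition bcontfun_of :: "nat \<Rightarrow> (nat \<Rightarrow> 'a::real_normed_vector) \<Rightarrow> nat discrete \<Rightarrow>\<^sub>C 'a" where
  "bcontfun_of n f = Bcontfun (\<lambda>d. if of_discrete d \<in> {1..n} then f (of_discrete d) else 0)"

lemma apply_bcontfun_of:
  "apply_bcontfun (bcontfun_of n f) d = (if of_discrete d \<in> {1..n} then f (of_discrete d) else 0)"
proof -
  have "(\<lambda>d. if of_discrete d \<in> {1..n} then f (of_discrete d) else 0) \<in> bcontfun"
  proof (rule bcontfun_normI)
    fix d
    show "norm (if of_discrete d \<in> {1..n} then f (of_discrete d) else 0) \<le> (\<Sum>i\<in>{1..n}. norm (f i))"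
      using member_le_sum[of "of_discrete d" "{1..n}" "\<lambda>i. norm (f i)"] sum_nonneg[of "{1..n}" "\<lambda>i. norm (f i)"]
      by (cases "of_discrete d \<in> {1..n}") simp_all
  qed (simp add: continuous_on_open_vimage open_discrete)
  then show ?thesis unfolding bcontfun_of_def by (simp add: Bcontfun_inverse)
qed

lemma lipschitz_bcontfun_of:
  fixes f :: "nat \<Rightarrow> 'e::metric_space \<Rightarrow> 'a::real_normed_vector"
  assumes "\<And>i. i \<in> {1..n} \<Longrightarrow> \<exists>L. L-lipschitz_on S (f i)"
  shows "\<exists>L. L-lipschitz_on S (\<lambda>y. bcontfun_of n (\<lambda>i. f i y))"
proof -
  obtain L where L: "\<And>i. i \<in> {1..n} \<Longrightarrow> L-lipschitz_on S (f i)"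
    using lipschitz_on_uniform_ex[of "{1..n}" S f] assms by blast
  have "(max L 0)-lipschitz_on S (\<lambda>y. bcontfun_of n (\<lambda>i. f i y))"
  proof (rule lipschitz_onI)
    fix y y' assume S: "y \<in> S" "y' \<in> S"
    show "dist (bcontfun_of n (\<lambda>i. f i y)) (bcontfun_of n (\<lambda>i. f i y')) \<le> max L 0 * dist y y'"
    proof (rule dist_bound)
      fix d
      have "dist (f i y) (f i y') \<le> max L 0 * dist y y'" if "i \<in> {1..n}" for i
        using lipschitz_onD[OF L[OF that] S] mult_right_mono[of L "max L 0" "dist y y'"] by simp
      then show "dist (apply_bcontfun (bcontfun_of n (\<lambda>i. f i y)) d) (apply_bcontfun (bcontfun_of n (\<lambda>i. f i y')) d)
          \<le> max L 0 * dist y y'"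
        by (simp add: apply_bcontfun_of)
    qed
  qed simp
  then show ?thesis ..
qed

text \<open>Evaluation at an index commutes with time derivatives, which turns the equation on
  states into equations for single particles.\<close>

lemma bounded_linear_apply_bcontfun:
  "bounded_linear (\<lambda>f :: 'a::topological_space \<Rightarrow>\<^sub>C 'b::real_normed_vector. apply_bcontfun f i)"
  by (rule bounded_linear_intro[where K = 1])
     (simp_all add: plus_bcontfun.rep_eq scaleR_bcontfun.rep_eq norm_bounded)

lemma lipschitz_state_component:
  "1-lipschitz_on S (\<lambda>y :: 'd::finite state. pos y i)"
  "1-lipschitz_on S (\<lambda>y :: 'd::finite state. vel y i)"
  by (rule lipschitz_onI; simp add: order_trans[OF dist_bounded dist_fst_le] order_trans[OF dist_bounded dist_snd_le])+

lemma continuous_on_state_component [continuous_intros]: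
  "continuous_on S (\<lambda>y :: 'd::finite state. pos y i)"
  "continuous_on S (\<lambda>y :: 'd::finite state. vel y i)"
  by (rule lipschitz_on_continuous_on, rule lipschitz_state_component)+

text \<open>One index \<open>k\<close> controls both cutoffs, and \<open>real k + 1\<close> keeps
  the separation meaningful at \<open>k = 0\<close>. Positions carry no bound because the control is
  globally Lipschitz.\<close>

definition cs_region :: "nat \<Rightarrow> nat \<Rightarrow> 'd::finite state set" where
  "cs_region n k =
     (\<Inter>i\<in>{1..n}. {y :: 'd state. norm (vel y i) \<le> real k}) \<inter>
     (\<Inter>i\<in>{1..n}. \<Inter>j\<in>{1..n} - {i}. {y :: 'd state. 1 / (real k + 1) \<le> norm (pos y i - pos y j)})"

lemma closed_cs_region: "closed (cs_region n k)"
  unfolding cs_region_def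
  by (intro closed_Int closed_INT ballI closed_Collect_le continuous_intros)

text \<open>Both bounds are strictly relaxed from \<open>k\<close> to \<open>Suc k\<close>, so the
  set given by the strict inequalities of level \<open>Suc k\<close> is open and lies between the
  two regions.\<close>

lemma cs_region_subset_interior: "cs_region n k \<subseteq> interior (cs_region n (Suc k))"
proof -
  let ?O = "(\<Inter>i\<in>{1..n}. {y :: 'a state. norm (vel y i) < real (Suc k)}) \<inter>
     (\<Inter>i\<in>{1..n}. \<Inter>j\<in>{1..n} - {i}. {y :: 'a state. 1 / (real (Suc k) + 1) < norm (pos y i - pos y j)})"
  have "open ?O"
    by (intro open_Int open_INT ballI finite_atLeastAtMost finite_Diff open_Collect_less continuous_intros)
  moreover have "?O \<subseteq> cs_region n (Suc k)"
    unfolding cs_region_def by (auto intro: less_imp_le)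
  ultimately have "?O \<subseteq> interior (cs_region n (Suc k))" by (intro interior_maximal)
  moreover have "cs_region n k \<subseteq> ?O"
  proof
    fix y :: "'a state" assume y: "y \<in> cs_region n k"
    have less: "1 / (real (Suc k) + 1) < 1 / (real k + 1)" by (simp add: field_simps)
    have "norm (vel y i) < real (Suc k)" if "i \<in> {1..n}" for i
      using y that by (force simp: cs_region_def)
    moreover have "1 / (real (Suc k) + 1) < norm (pos y i - pos y j)" if "i \<in> {1..n}" "j \<in> {1..n} - {i}" for i j
    proof -
      have "1 / (real k + 1) \<le> norm (pos y i - pos y j)"
        using y that unfolding cs_region_def by blast
      with less show ?thesis by (rule less_le_trans)
    qed
    ultimately show "y \<in> ?O" by blast
  qed
  ultimately show ?thesis by blast
qed

lemma ex_cs_region: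
  assumes "0 < \<epsilon>"
  obtains k where "\<And>y :: 'd::finite state. (\<And>i. i \<in> {1..n} \<Longrightarrow> norm (vel y i) \<le> R) \<Longrightarrow>
    (\<And>i j. i \<in> {1..n} \<Longrightarrow> j \<in> {1..n} \<Longrightarrow> i \<noteq> j \<Longrightarrow> \<epsilon> \<le> norm (pos y i - pos y j)) \<Longrightarrow> y \<in> cs_region n k"
proof -
  obtain k :: nat where k: "max R (1 / \<epsilon>) \<le> real k" using real_arch_simple by blast
  then have "1 / \<epsilon> \<le> real k + 1" by simp
  then have *: "1 / (real k + 1) \<le> \<epsilon>" using \<open>0 < \<epsilon>\<close> by (simp add: field_simps)
  show ?thesis
  proof (rule that)
    fix y :: "'d state"
    assume v: "\<And>i. i \<in> {1..n} \<Longrightarrow> norm (vel y i) \<le> R"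
      and x: "\<And>i j. i \<in> {1..n} \<Longrightarrow> j \<in> {1..n} \<Longrightarrow> i \<noteq> j \<Longrightarrow> \<epsilon> \<le> norm (pos y i - pos y j)"
    have "norm (vel y i) \<le> real k" if "i \<in> {1..n}" for i
      using v[OF that] k by simp
    moreover have "1 / (real k + 1) \<le> norm (pos y i - pos y j)" if "i \<in> {1..n}" "j \<in> {1..n} - {i}" for i j
      using x[of i j] that * by (intro order_trans[OF *]) auto
    ultimately show "y \<in> cs_region n k" unfolding cs_region_def by blast
  qed
qed

lemma cs_regionD:
  fixes y :: "'d::finite state"
  assumes "y \<in> cs_region n k"
  shows "i \<in> {1..n} \<Longrightarrow> norm (vel y i) \<le> real k"
    and "i \<in> {1..n} \<Longrightarrow> j \<in> {1..n} \<Longrightarrow> i \<noteq> j \<Longrightarrow> 1 / (real k + 1) \<le> norm (pos y i - pos y j)"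
  using assms unfolding cs_region_def by blast+

definition cs_field ::
    "nat \<Rightarrow> real \<Rightarrow> real \<Rightarrow> real \<Rightarrow> real \<Rightarrow> (nat \<Rightarrow> real ^ 'd::finite) \<Rightarrow> 'd state \<Rightarrow> 'd state" where
  "cs_field n K M \<alpha> \<beta> z y = (snd y, bcontfun_of n (cs_acc n K M \<alpha> \<beta> z (pos y) (vel y)))"

lemma cs_field_component_derivatives:
  assumes "(y has_vector_derivative cs_field n K M \<alpha> \<beta> z (y t)) (at t within S)" "i \<in> {1..n}"
  shows "((\<lambda>t. pos (y t) i) has_vector_derivative vel (y t) i) (at t within S)"
    and "((\<lambda>t. vel (y t) i) has_vector_derivative cs_acc n K M \<alpha> \<beta> z (pos (y t)) (vel (y t)) i) (at t within S)"
  using bounded_linear.has_vector_derivative[OF bounded_linear_compose[OF bounded_linear_apply_bcontfun[of "discrete i"] bounded_linear_fst] assms(1)]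
    bounded_linear.has_vector_derivative[OF bounded_linear_compose[OF bounded_linear_apply_bcontfun[of "discrete i"] bounded_linear_snd] assms(1)]
    assms(2)
  by (simp_all add: cs_field_def apply_bcontfun_of)

section \<open>Global existence for the controlled system\<close>

lemma cs_global_solution:
  fixes z x0 v0 :: "nat \<Rightarrow> real ^ 'd"
  assumes params: "2 \<le> n" "0 < K" "0 \<le> M" "0 < \<beta>" and "1 \<le> \<alpha>"
    and ne0: "\<And>i j. i \<in> {1..n} \<Longrightarrow> j \<in> {1..n} \<Longrightarrow> i \<noteq> j \<Longrightarrow> x0 i \<noteq> x0 j"
  obtains x v :: "nat \<Rightarrow> real \<Rightarrow> real ^ 'd" where
    "\<And>i. i \<in> {1..n} \<Longrightarrow> x i 0 = x0 i \<and> v i 0 = v0 i"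
    "\<And>i t. i \<in> {1..n} \<Longrightarrow> 0 \<le> t \<Longrightarrow> (x i has_vector_derivative v i t) (at t within {0..})"
    "\<And>i t. i \<in> {1..n} \<Longrightarrow> 0 \<le> t \<Longrightarrow>
      (v i has_vector_derivative cs_acc n K M \<alpha> \<beta> z (\<lambda>k. x k t) (\<lambda>k. v k t) i) (at t within {0..})"
    "\<And>i j t. i \<in> {1..n} \<Longrightarrow> j \<in> {1..n} \<Longrightarrow> i \<noteq> j \<Longrightarrow> 0 \<le> t \<Longrightarrow> x i t \<noteq> x j t"
proof -
  let ?I = "{1..n}"
  let ?F = "cs_field n K M \<alpha> \<beta> z"
  define y0 :: "'d state" where "y0 = (bcontfun_of n x0, bcontfun_of n v0)"
  \<comment> \<open>The cutoff parameters are those of \<open>cs_region n k\<close>, so the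
    truncation is inactive there.\<close>
  define G where "G k y = (snd y, bcontfun_of n
      (\<lambda>i. truncated_cs_acc (1 / (real k + 1)) (real k) n K M \<alpha> \<beta> z (pos y) (vel y) i))" for k and y :: "'d state"
  obtain m where m: "y0 \<in> cs_region n m"
  proof -
    have "\<exists>e>0. \<forall>s\<in>{s \<in> ?I \<times> ?I. fst s \<noteq> snd s}. e \<le> norm (x0 (fst s) - x0 (snd s))"
    proof (rule finite_uniform_eps)
      fix s assume "s \<in> {s \<in> ?I \<times> ?I. fst s \<noteq> snd s}"
      then show "\<exists>e>0. e \<le> norm (x0 (fst s) - x0 (snd s))"
        using ne0[of "fst s" "snd s"] by (intro exI[of _ "norm (x0 (fst s) - x0 (snd s))"]) auto
    qed auto
    then obtain e where e: "0 < e" "\<And>i j. i \<in> ?I \<Longrightarrow> j \<in> ?I \<Longrightarrow> i \<noteq> j \<Longrightarrow> e \<le> norm (x0 i - x0 j)"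
      by auto
    have "norm (v0 i) \<le> (\<Sum>i\<in>?I. norm (v0 i))" if "i \<in> ?I" for i
      using that by (intro member_le_sum) auto
    moreover obtain k where "\<And>y :: 'd state. (\<And>i. i \<in> ?I \<Longrightarrow> norm (vel y i) \<le> (\<Sum>i\<in>?I. norm (v0 i))) \<Longrightarrow>
      (\<And>i j. i \<in> ?I \<Longrightarrow> j \<in> ?I \<Longrightarrow> i \<noteq> j \<Longrightarrow> e \<le> norm (pos y i - pos y j)) \<Longrightarrow> y \<in> cs_region n k"
      using ex_cs_region[OF e(1)] by blast
    ultimately have "y0 \<in> cs_region n k" using e(2) by (simp add: y0_def apply_bcontfun_of)
    then show ?thesis by (rule that)
  qed
  obtain y where y: "y 0 = y0" "\<And>t. 0 \<le> t \<Longrightarrow> y t \<in> (\<Union>k. cs_region n k)"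
    "\<And>t. 0 \<le> t \<Longrightarrow> (y has_vector_derivative ?F (y t)) (at t within {0..})"
  proof (rule ode_continuation[where G = G and F = ?F and U = "cs_region n", OF _ _ closed_cs_region cs_region_subset_interior m])
    fix k
    have "\<exists>L. L-lipschitz_on UNIV (\<lambda>y :: 'd state. bcontfun_of n
        (\<lambda>i. truncated_cs_acc (1 / (real k + 1)) (real k) n K M \<alpha> \<beta> z (\<lambda>l. pos y l) (\<lambda>l. vel y l) i))"
    proof (rule lipschitz_bcontfun_of)
      fix i
      show "\<exists>L. L-lipschitz_on UNIV (\<lambda>y :: 'd state.
          truncated_cs_acc (1 / (real k + 1)) (real k) n K M \<alpha> \<beta> z (\<lambda>l. pos y l) (\<lambda>l. vel y l) i)"
        using params \<open>1 \<le> \<alpha>\<close> lipschitz_state_component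
        by (intro lipschitz_truncated_cs_acc[where x = "\<lambda>l y. pos y l" and v = "\<lambda>l y. vel y l"]) (simp | blast)+
    qed
    then obtain L where L: "L-lipschitz_on UNIV (\<lambda>y :: 'd state. bcontfun_of n
        (\<lambda>i. truncated_cs_acc (1 / (real k + 1)) (real k) n K M \<alpha> \<beta> z (\<lambda>l. pos y l) (\<lambda>l. vel y l) i))" ..
    have "1-lipschitz_on UNIV (snd :: 'd state \<Rightarrow> _)"
      by (intro lipschitz_onI) (auto intro: dist_snd_le)
    from lipschitz_on_Pair[OF this L] show "\<exists>L. L-lipschitz_on UNIV (G k)"
      unfolding G_def by blast
  next
    fix k and y :: "'d state" assume y: "y \<in> cs_region n k"
    have "bcontfun_of n (truncated_cs_acc (1 / (real k + 1)) (real k) n K M \<alpha> \<beta> z (pos y) (vel y))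
        = bcontfun_of n (cs_acc n K M \<alpha> \<beta> z (pos y) (vel y))"
    proof (rule bcontfun_eqI)
      fix i
      show "apply_bcontfun (bcontfun_of n (truncated_cs_acc (1 / (real k + 1)) (real k) n K M \<alpha> \<beta> z (pos y) (vel y))) i
          = apply_bcontfun (bcontfun_of n (cs_acc n K M \<alpha> \<beta> z (pos y) (vel y))) i"
        unfolding apply_bcontfun_of
        by (intro if_cong refl truncated_cs_acc_eq) (use cs_regionD[OF y] in auto)
    qed
    then show "G k y = ?F y" by (simp add: G_def cs_field_def)
  next
    \<comment> \<open>The case that uses the dynamics: the velocity bound \<open>R\<close> and the
      separation \<open>\<epsilon>\<close> on \<open>{0..<T}\<close> together place the whole curve
      in one region.\<close>
    fix y :: "real \<Rightarrow> 'd state" and T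
    assume "0 < T" and y: "y 0 = y0" "\<And>t. t \<in> {0..<T} \<Longrightarrow> y t \<in> (\<Union>k. cs_region n k)"
      "\<And>t. t \<in> {0..<T} \<Longrightarrow> (y has_vector_derivative ?F (y t)) (at t within {0..<T})"
    let ?x = "\<lambda>i t. pos (y t) i" and ?v = "\<lambda>i t. vel (y t) i"
    have dx: "(?x i has_vector_derivative ?v i t) (at t within {0..<T})"
      and dv: "(?v i has_vector_derivative cs_acc n K M \<alpha> \<beta> z (\<lambda>k. ?x k t) (\<lambda>k. ?v k t) i) (at t within {0..<T})"
      if "i \<in> ?I" "t \<in> {0..<T}" for i t
      using cs_field_component_derivatives[OF y(3)[OF that(2)] that(1)] by auto
    have ne: "?x i t \<noteq> ?x j t" if ij: "i \<in> ?I" "j \<in> ?I" "i \<noteq> j" "t \<in> {0..<T}" for i j t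
    proof -
      obtain k where "y t \<in> cs_region n k" using y(2)[OF ij(4)] by blast
      then have "1 / (real k + 1) \<le> norm (?x i t - ?x j t)" using ij by (intro cs_regionD(2))
      moreover have "0 < 1 / (real k + 1)" by simp
      ultimately show ?thesis by auto
    qed
    obtain R where R: "\<And>i t. i \<in> ?I \<Longrightarrow> t \<in> {0..<T} \<Longrightarrow> norm (?x i t) \<le> R \<and> norm (?v i t) \<le> R"
      by (rule cs_bounded[where x = ?x and v = ?v, OF params dx dv]) blast+
    obtain \<epsilon> where \<epsilon>: "0 < \<epsilon>"
      "\<And>i j t. i \<in> ?I \<Longrightarrow> j \<in> ?I \<Longrightarrow> i \<noteq> j \<Longrightarrow> t \<in> {0..<T} \<Longrightarrow> \<epsilon> \<le> norm (?x i t - ?x j t)"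
      by (rule cs_no_collision[where x = ?x and v = ?v, OF params \<open>1 \<le> \<alpha>\<close> \<open>0 < T\<close> dx dv ne]) blast+
    obtain k where "\<And>y :: 'd state. (\<And>i. i \<in> ?I \<Longrightarrow> norm (vel y i) \<le> R) \<Longrightarrow>
      (\<And>i j. i \<in> ?I \<Longrightarrow> j \<in> ?I \<Longrightarrow> i \<noteq> j \<Longrightarrow> \<epsilon> \<le> norm (pos y i - pos y j)) \<Longrightarrow> y \<in> cs_region n k"
      using ex_cs_region[OF \<epsilon>(1)] by blast
    then have "y t \<in> cs_region n k" if "t \<in> {0..<T}" for t
      using R[OF _ that] \<epsilon>(2)[OF _ _ _ that] by blast
    then show "\<exists>k. \<forall>t\<in>{0..<T}. y t \<in> cs_region n k" by blast
  qed blast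
  show ?thesis
  proof (rule that[of "\<lambda>i t. pos (y t) i" "\<lambda>i t. vel (y t) i"])
    fix i assume "i \<in> ?I"
    then show "pos (y 0) i = x0 i \<and> vel (y 0) i = v0 i"
      by (simp add: y(1) y0_def apply_bcontfun_of)
  next
    fix i t assume it: "i \<in> ?I" "0 \<le> (t :: real)"
    show "((\<lambda>t. pos (y t) i) has_vector_derivative vel (y t) i) (at t within {0..})"
      "((\<lambda>t. vel (y t) i) has_vector_derivative
        cs_acc n K M \<alpha> \<beta> z (\<lambda>k. pos (y t) k) (\<lambda>k. vel (y t) k) i) (at t within {0..})"
      using cs_field_component_derivatives[OF y(3)[OF it(2)] it(1)] by auto
  next
    fix i j t assume ij: "i \<in> ?I" "j \<in> ?I" "i \<noteq> j" and t: "0 \<le> (t :: real)"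
    obtain k where "y t \<in> cs_region n k" using y(2)[OF t] by blast
    then have "1 / (real k + 1) \<le> norm (pos (y t) i - pos (y t) j)" using ij by (intro cs_regionD(2))
    moreover have "0 < 1 / (real k + 1)" by simp
    ultimately show "pos (y t) i \<noteq> pos (y t) j" by auto
  qed
qed

text \<open>The pair of particles 1 and 2 makes the set of distances nonempty, so that
  \<open>Min\<close> of this finite set is a genuine minimum.\<close>

lemma min_distance_pos_iff:
  assumes "2 \<le> n"
  shows "0 < min_distance n y \<longleftrightarrow> (\<forall>i\<in>{1..n}. \<forall>j\<in>{1..n}. i \<noteq> j \<longrightarrow> y i \<noteq> y j)"
proof -
  let ?D = "{norm (y i - y j) | i j. i \<in> {1..n} \<and> j \<in> {1..n} \<and> i \<noteq> j}"
  have "?D \<subseteq> (\<lambda>(i, j). norm (y i - y j)) ` ({1..n} \<times> {1..n})" by auto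
  then have "finite ?D" by (rule finite_subset) auto
  moreover have "norm (y 1 - y 2) \<in> ?D" using assms by force
  ultimately have "0 < min_distance n y \<longleftrightarrow> (\<forall>d\<in>?D. 0 < d)"
    unfolding min_distance_def by (intro Min_gr_iff) auto
  also have "\<dots> \<longleftrightarrow> (\<forall>i\<in>{1..n}. \<forall>j\<in>{1..n}. i \<noteq> j \<longrightarrow> 0 < norm (y i - y j))" by blast
  finally show ?thesis by simp
qed

theorem theorem4p1:
  fixes n :: nat and K M \<alpha> \<beta> :: real
    and z x0 v0 :: "nat \<Rightarrow> real ^ 'd"
  assumes "n \<ge> 2" and "K > 0" and "M \<ge> 0" and "\<alpha> \<ge> 1" and "\<beta> > 0"
    and "min_distance n x0 > 0"
  shows "\<exists>x v :: nat \<Rightarrow> real \<Rightarrow> real ^ 'd.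
           controlled_CS_solution n K M \<alpha> \<beta> z x v \<and>
           (\<forall>i\<in>{1..n}. smooth_on {0..} (x i) \<and> smooth_on {0..} (v i)) \<and>
           (\<forall>i\<in>{1..n}. x i 0 = x0 i \<and> v i 0 = v0 i) \<and>
           (\<forall>t\<ge>0. min_distance n (\<lambda>i. x i t) > 0)"
proof -
  have "x0 i \<noteq> x0 j" if "i \<in> {1..n}" "j \<in> {1..n}" "i \<noteq> j" for i j
    using assms(6) that unfolding min_distance_pos_iff[OF assms(1)] by blast
  from cs_global_solution[where ?x0.0 = x0 and ?v0.0 = v0 and z = z, OF assms(1,2,3,5,4) this]
  obtain x v where
    init: "\<And>i. i \<in> {1..n} \<Longrightarrow> x i 0 = x0 i \<and> v i 0 = v0 i" and
    x: "\<And>i t. i \<in> {1..n} \<Longrightarrow> 0 \<le> t \<Longrightarrow> (x i has_vector_derivative v i t) (at t within {0..})" and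
    v: "\<And>i t. i \<in> {1..n} \<Longrightarrow> 0 \<le> t \<Longrightarrow>
      (v i has_vector_derivative cs_acc n K M \<alpha> \<beta> z (\<lambda>k. x k t) (\<lambda>k. v k t) i) (at t within {0..})" and
    ne: "\<And>i j t. i \<in> {1..n} \<Longrightarrow> j \<in> {1..n} \<Longrightarrow> i \<noteq> j \<Longrightarrow> 0 \<le> t \<Longrightarrow> x i t \<noteq> x j t"
    by blast
  have "controlled_CS_solution n K M \<alpha> \<beta> z x v"
    using x v unfolding controlled_CS_solution_def cs_acc_def by blast
  moreover have "smooth_on {0..} (x i)" "smooth_on {0..} (v i)" if "i \<in> {1..n}" for i
    using cs_smooth[OF assms(1) x v ne that] by blast+
  moreover have "\<forall>t\<ge>0. min_distance n (\<lambda>i. x i t) > 0"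
    unfolding min_distance_pos_iff[OF assms(1)] using ne by blast
  ultimately show ?thesis using init by blast
qed

end
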